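(* Let $R>3/2$, let $b=1-R$ (so $b<-1/2$), and let $F_n$, $n\ge1$, be the Faber polynomials of the (real-symmetric) Joukowski airfoil $K$ with parameter $R$. Then all zeros of $\{F_n\}$ accumulate on $\mathcal L_b^+\cup I_b$ (that is, for every open neighborhood $N$ of $\mathcal L_b^+\cup I_b$, all zeros of $F_n$ lie in $N$ for all sufficiently large $n$). Moreover, $$\lim_{n\to\infty}\mu_n=(U^{-1})_*(\mu_{[-1,1]})|_{I_b}+(\phi_b^{-1})_*(\eta|_{(c_+,c_-)})\quad\text{weak-*},$$ where $\mu_n$ is the normalized counting measure of the zeros of $F_n$.
   Context: Let $J(\zeta)=\frac12(\zeta+1/\zeta)$ and, for $R>1$ and $b=1-R$, let $T(z)=Rz+b$ and $\Psi=J\circ T$. The map $\Psi$ is a conformal map of $\{|z|>1\}\cup\{\infty\}$ onto $\overline{\mathbb C}\setminus K$ with $\Psi(\infty)=\infty$, where $K$ is a compact set called the Joukowski airfoil with parameter $R$ (real case). The Faber polynomials $F_n$ of $K$ are defined, for $|w|$ large, by $$\frac{\Psi'(w)}{\Psi(w)-z}=\sum_{n=0}^\infty\frac{F_n(z)}{w^{n+1}};$$ $F_n$ is a polynomial of degree $n$. If $z_1^{(n)},\dots,z_n^{(n)}$ are its zeros (with multiplicity), then $\mu_n=\frac1n\sum_{j=1}^n\delta_{z_j^{(n)}}$. Put $I_b=[\frac1{2b},1]\subset[-1,1]$. The function $$U(x)=\frac{x-b}{\sqrt{b^2+1-2bx}}$$ (positive square root) is an increasing bijection of $I_b$ onto $[1-\frac1{2b^2},1]$.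 The measure $\mu_{[-1,1]}=\frac1\pi\frac{dx}{\sqrt{1-x^2}}$ is the equilibrium measure of $[-1,1]$; $f_*(\nu)$ denotes the push-forward of $\nu$ by $f$; and $(U^{-1})_*(\mu_{[-1,1]})|_{I_b}$ denotes the push-forward, by the inverse of $U:I_b\to U(I_b)$, of the restriction of $\mu_{[-1,1]}$ to $U(I_b)=[1-\frac{1}{2b^2},1]$. Let $$\phi_b(z)=\frac{b-z-\sqrt{z^2-1}}{b},$$ where $\sqrt{z^2-1}$ has branch cut $[-1,1]$ and behaves like $z$ at infinity; $(\phi_b)_+(x)$ and $(\phi_b)_-(x)$ denote the limits of $\phi_b(z)$ as $z\to x\in[-1,1]$ from above and from below, respectively. Let $$\mathcal L_b^+=\{z\in\mathbb C:\ |\phi_b(z)|=1\}$$ (on the cut, a point is included when the boundary values of $\phi_b$ have modulus one). It is a closed loop, symmetric about the real axis, containing the point $\frac1{2b}$. Set $$c_\pm=(\phi_b)_\pm\left(\tfrac1{2b}\right)=1-\frac1{2b^2}\mp\frac ib\sqrt{1-\frac1{4b^2}},$$ which are points of the unit circle $\mathbb T$. Let $(c_+,c_-)$ be the arc of $\mathbb T$ from $c_+$ to $c_-=\overline{c_+}$ traversed counterclockwise (this arc does not contain $1$). The map $\phi_b$ is a bijection from $\mathcal L_b^+\setminus\{\frac1{2b}\}$ onto the open arc, and $\phi_b^{-1}$ denotes its inverse. Finally $\eta=\frac1{2\pi}d\theta$ is the normalized arc-length measure on $\mathbb T$, and $\eta|_{(c_+,c_-)}$ is its restriction to the arc. *)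

theory Defs
  imports "HOL-Probability.Probability" "HOL-Computational_Algebra.Computational_Algebra"
begin

definition joukowski :: "complex \<Rightarrow> complex" where
  "joukowski \<zeta> = (\<zeta> + 1 / \<zeta>) / 2"

text \<open>The airfoil \<open>K\<close> with parameter \<open>R > 1\<close> is the complement in the plane of the image of
  \<open>{w. norm w > 1}\<close> under this map, the exterior conformal map of \<open>K\<close>.\<close>

definition airfoil_map :: "real \<Rightarrow> complex \<Rightarrow> complex" where
  "airfoil_map R w = joukowski (of_real R * w + of_real (1 - R))"

text \<open>\<open>F\<close> is the sequence of Faber polynomials of a compact set with exterior conformal map \<open>\<Psi>\<close>.
  How large \<open>w\<close> must be may depend on \<open>z\<close>. The relation determines \<open>F\<close> uniquely.\<close>

definition faber_polynomials :: "(complex \<Rightarrow> complex) \<Rightarrow> (nat \<Rightarrow> complex poly) \<Rightarrow> bool" where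
  "faber_polynomials \<Psi> F \<longleftrightarrow>
     (\<forall>z. \<forall>\<^sub>F w in at_infinity.
        (\<lambda>n. poly (F n) z / w ^ (n + 1)) sums (deriv \<Psi> w / (\<Psi> w - z)))"

text \<open>Zeros are counted with multiplicity; over the complex numbers a polynomial of degree
  \<open>n \<ge> 1\<close> has \<open>n\<close> of them, so each occurrence of a zero carries mass \<open>1/n\<close>.\<close>

definition normalized_zero_measure :: "complex poly \<Rightarrow> complex measure" where
  "normalized_zero_measure p = distr (measure_pmf (pmf_of_multiset (proots p))) borel (\<lambda>z. z)"

definition weak_star_conv :: "(nat \<Rightarrow> complex measure) \<Rightarrow> complex measure \<Rightarrow> bool" where
  "weak_star_conv M \<mu> \<longleftrightarrow>
     (\<forall>f :: complex \<Rightarrow> real. continuous_on UNIV f \<longrightarrow> compact (closure {z. f z \<noteq> 0}) \<longrightarrow>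
        (\<lambda>n. integral\<^sup>L (M n) f) \<longlonglongrightarrow> integral\<^sup>L \<mu> f)"

definition add_measure :: "'a measure \<Rightarrow> 'a measure \<Rightarrow> 'a measure" where
  "add_measure M N = measure_of (space M) (sets M) (\<lambda>A. emeasure M A + emeasure N A)"

lemma emeasure_add_measure:
  assumes "sets M = sets N" and "A \<in> sets M"
  shows "emeasure (add_measure M N) A = emeasure M A + emeasure N A"
proof (rule emeasure_measure_of[OF add_measure_def])
  show "countably_additive (sets (add_measure M N)) (\<lambda>A. emeasure M A + emeasure N A)"
  proof (rule countably_additiveI)
    fix B :: "nat \<Rightarrow> 'a set"
    assume B: "range B \<subseteq> sets (add_measure M N)" "disjoint_family B"
    have M: "range B \<subseteq> sets M" using B(1) by (simp add: add_measure_def)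
    have N: "range B \<subseteq> sets N" using M assms(1) by simp
    show "(\<Sum>i. emeasure M (B i) + emeasure N (B i)) = emeasure M (\<Union> (range B)) + emeasure N (\<Union> (range B))"
      using suminf_emeasure[OF M B(2)] suminf_emeasure[OF N B(2)] by (simp add: suminf_add[symmetric])
  qed
qed (use assms in \<open>auto simp: add_measure_def positive_def sets.space_closed
      dest: sets.sets_into_space\<close>)

definition interval_I :: "real \<Rightarrow> real set" where
  "interval_I b = {1 / (2 * b)..1}"

definition map_U :: "real \<Rightarrow> real \<Rightarrow> real" where
  "map_U b x = (x - b) / sqrt (b\<^sup>2 + 1 - 2 * b * x)"

definition arcsine_measure :: "real measure" where
  "arcsine_measure =
     density lborel (\<lambda>x. ennreal (indicator {-1..1} x / (pi * sqrt (1 - x\<^sup>2))))"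

text \<open>The product of the two principal roots is the branch of \<open>sqrt (z\<^sup>2 - 1)\<close> that is
  holomorphic off \<open>[-1,1]\<close> and asymptotic to \<open>z\<close> at infinity: the sign changes of the factors
  across \<open>z < -1\<close> cancel.\<close>

definition sqrt_cut :: "complex \<Rightarrow> complex" where
  "sqrt_cut z = csqrt (z - 1) * csqrt (z + 1)"

definition phi :: "real \<Rightarrow> complex \<Rightarrow> complex" where
  "phi b z = (of_real b - z - sqrt_cut z) / of_real b"

definition phi_plus :: "real \<Rightarrow> real \<Rightarrow> complex" where
  "phi_plus b x = Lim (at (of_real x) within {z. Im z > 0}) (phi b)"

definition phi_minus :: "real \<Rightarrow> real \<Rightarrow> complex" where
  "phi_minus b x = Lim (at (of_real x) within {z. Im z < 0}) (phi b)"

definition loop_L :: "real \<Rightarrow> complex set" where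
  "loop_L b =
     {z. z \<notin> of_real ` {-1..1} \<and> norm (phi b z) = 1} \<union>
     of_real ` {x \<in> {-1..1}. norm (phi_plus b x) = 1 \<and> norm (phi_minus b x) = 1}"

text \<open>The open arc of the unit circle traversed counterclockwise from \<open>u\<close> to \<open>v\<close>.\<close>

definition ccw_arc :: "complex \<Rightarrow> complex \<Rightarrow> complex set" where
  "ccw_arc u v = (\<lambda>t. u * cis t) ` {0<..<Arg2pi (v / u)}"

definition circle_measure :: "complex measure" where
  "circle_measure = distr (uniform_measure lborel {0..<2 * pi}) borel cis"

definition interval_part :: "real \<Rightarrow> complex measure" where
  "interval_part b =
     distr (restrict_space arcsine_measure (map_U b ` interval_I b)) borel
       (\<lambda>y. of_real (the_inv_into (interval_I b) (map_U b) y))"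

definition loop_part :: "real \<Rightarrow> complex measure" where
  "loop_part b =
     distr
       (restrict_space circle_measure
          (ccw_arc (phi_plus b (1 / (2 * b))) (phi_minus b (1 / (2 * b))))) borel
       (the_inv_into (loop_L b - {of_real (1 / (2 * b))}) (phi b))"

end

theory Submission
  imports Defs
begin

text \<open>
  Put \<open>u = \<phi>\<^sub>b z = 1 - \<zeta> / b\<close>, where \<open>\<zeta>\<close> is the root of \<open>J \<zeta> = z\<close> of modulus at least one, and let
  \<open>v = 1 - 1 / (b \<zeta>)\<close> be the same expression at the other root \<open>1 / \<zeta>\<close>. The generating function
  \<open>\<Psi>' / (\<Psi> - z)\<close> is a sum of three simple fractions in \<open>w\<close>, so \<open>F\<^sub>n\<close> is explicit and its zeros are
  exactly the solutions of \<open>u\<^sup>n + v\<^sup>n = 1\<close> (\<open>faber_zero_iff\<close>).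

  Location of the zeros. A limit point of solutions with growing \<open>n\<close> cannot have one of the three
  numbers \<open>|u|\<close>, \<open>|v|\<close>, \<open>1\<close> strictly larger than the other two (\<open>limiting_tie\<close>). The possible ties are
  \<open>|u| = |v| \<ge> 1\<close>, which happens for \<open>|\<zeta>| = 1\<close> and \<open>z \<in> I\<^sub>b\<close>, and \<open>|u| = 1 \<ge> |v|\<close>, which is the loop
  (\<open>tie_location\<close>). Zeros stay bounded, so compactness gives the accumulation statement.

  Distribution of the zeros. No potential theory is involved: almost all zeros are exhibited one by
  one. Cut the circle of angles into \<open>n\<close> cells of length \<open>2 \<pi> / n\<close>, and call \<open>c = 1 - 1 / (2 b\<^sup>2)\<close> the
  cosine at which interval and loop meet.
  On the interval \<open>u\<close> and \<open>v\<close> are conjugate, \<open>U x\<close> is the cosine of \<open>arg u\<close>, and the equation becomes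
  \<open>2 |u|\<^sup>n cos (n \<alpha>) = 1\<close> with \<open>cos \<alpha> = U x\<close> and \<open>|u| \<ge> 1\<close>. The intermediate value theorem
  gives a zero in the first half of every cell on which \<open>cos \<ge> c\<close> (\<open>interval_zero_exists\<close>).
  Near the loop \<open>|v| < 1\<close>, so \<open>u\<close> is a small perturbation of an \<open>n\<close>-th root of unity: Brouwer's
  theorem solves \<open>u = \<omega> (1 - v\<^sup>n)\<^bsup>1/n\<^esup>\<close> for the root of unity \<open>\<omega>\<close> of every cell in the remaining range,
  apart from its ends (\<open>loop_zero_exists\<close>). Zeros of different cells are different (\<open>cell_zero_inj\<close>), and
  \<open>F\<^sub>n\<close> has at most \<open>n\<close> zeros.

  Both parts of the limit measure are push-forwards of the uniform angle, since the arcsine law is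
  the law of its cosine. Hence the limit is the law of one function \<open>limit_curve b\<close> of a uniform angle
  \<open>t\<close> (\<open>limit_measure_eq_distr\<close>), and for almost every \<open>t\<close> the zero of the cell containing \<open>t\<close> exists for
  large \<open>n\<close> and tends to \<open>limit_curve b t\<close>. Dominated convergence turns this into convergence
  of the sums over the exhibited zeros. For a test function \<open>g \<ge> 0\<close> these sums bound the integral
  against the zero measure from below, and applying this to \<open>M + f\<close> and \<open>M - f\<close> gives the limit
  from both sides (\<open>zero_measure_limit_from_cells\<close>).
\<close>

section \<open>Faber polynomials of the airfoil in the Joukowski coordinate\<close>

text \<open>The constant coefficient is the limit at \<open>0\<close>; the rest follows by dividing by \<open>t\<close>.\<close>

lemma powser_eq_zero:
  fixes d :: "nat \<Rightarrow> complex"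
  assumes s: "s > 0" and sm: "\<And>t. t \<noteq> 0 \<Longrightarrow> norm t < s \<Longrightarrow> (\<lambda>n. d n * t ^ n) sums 0"
  shows "d n = 0"
  using sm
proof (induction n arbitrary: d)
  case 0
  have "((\<lambda>t::complex. 0::complex) \<longlongrightarrow> d 0) (at 0)"
    by (rule powser_limit_0_strong[OF s, of d "\<lambda>_. 0"]) (use 0 in auto)
  then show ?case using LIM_unique tendsto_const by blast
next
  case (Suc n)
  have d0: "d 0 = 0"
  proof -
    have "((\<lambda>t::complex. 0::complex) \<longlongrightarrow> d 0) (at 0)"
      by (rule powser_limit_0_strong[OF s, of d "\<lambda>_. 0"]) (use Suc.prems in auto)
    then show ?thesis using LIM_unique tendsto_const by blast
  qed
  show ?case
  proof (rule Suc.IH[of "\<lambda>n. d (Suc n)"])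
    fix t :: complex assume t: "t \<noteq> 0" "norm t < s"
    have "(\<lambda>n. d (Suc n) * t ^ Suc n) sums 0"
      using Suc.prems[OF t] d0 sums_Suc_iff[of "\<lambda>n. d n * t ^ n" 0] by simp
    from sums_mult[OF this, of "1/t"] show "(\<lambda>n. d (Suc n) * t ^ n) sums 0"
      using t by (simp add: field_simps)
  qed
qed

text \<open>\<open>\<zeta>\<close> and \<open>1 / \<zeta>\<close> are the two roots of one quadratic equation.\<close>

lemma joukowski_eq_imp:
  assumes "\<zeta> \<noteq> 0" "\<xi> \<noteq> 0" "joukowski \<zeta> = joukowski \<xi>"
  shows "\<zeta> = \<xi> \<or> \<zeta> = 1 / \<xi>"
proof -
  have "\<zeta> + 1 / \<zeta> = \<xi> + 1 / \<xi>"
    using assms(3) unfolding joukowski_def by (metis nonzero_eq_divide_eq zero_neq_numeral)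
  then have "(\<zeta> - \<xi>) * (\<zeta> * \<xi> - 1) = 0"
    using assms(1,2) by (simp add: field_simps)
  then have "\<zeta> = \<xi> \<or> \<zeta> * \<xi> = 1" by simp
  then show ?thesis using assms(2) by (metis nonzero_eq_divide_eq)
qed

text \<open>As a function of \<open>T = R w + 1 - R\<close> the difference \<open>J T - J \<zeta>\<close> is \<open>(T - \<zeta>) (T - 1 / \<zeta>) / (2 T)\<close>. Its
  logarithmic derivative therefore has two simple poles from the numerator and one from the
  denominator.\<close>

lemma airfoil_log_deriv:
  fixes R :: real
  assumes \<zeta>: "\<zeta> \<noteq> 0" and R: "R \<noteq> 0" and w0: "of_real R * w + of_real (1 - R) \<noteq> 0"
    and w1: "of_real R * w + of_real (1 - R) \<noteq> \<zeta>"
    and w2: "of_real R * w + of_real (1 - R) \<noteq> 1 / \<zeta>"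
  shows "deriv (airfoil_map R) w / (airfoil_map R w - joukowski \<zeta>)
       = 1 / (w - (\<zeta> - of_real (1 - R)) / of_real R) + 1 / (w - (1 / \<zeta> - of_real (1 - R)) / of_real R)
         - 1 / (w - (- of_real (1 - R)) / of_real R)"
proof -
  define T where "T = of_real R * w + complex_of_real (1 - R)"
  have T: "T \<noteq> 0" "T \<noteq> \<zeta>" "T \<noteq> 1 / \<zeta>" using assms by (simp_all add: T_def)
  have "(airfoil_map R has_field_derivative of_real R * (1 - 1 / T\<^sup>2) / 2) (at w)"
  proof -
    have "(joukowski has_field_derivative (1 - 1 / T\<^sup>2) / 2) (at T)"
      unfolding joukowski_def using T(1)
      by (auto intro!: derivative_eq_intros simp: power2_eq_square field_simps)
    moreover have "((\<lambda>w. of_real R * w + complex_of_real (1 - R)) has_field_derivative of_real R) (at w)"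
      by (auto intro!: derivative_eq_intros)
    ultimately have "((\<lambda>w. joukowski (of_real R * w + complex_of_real (1 - R)))
        has_field_derivative (1 - 1 / T\<^sup>2) / 2 * of_real R) (at w)"
      unfolding T_def by (rule DERIV_chain2)
    then show ?thesis unfolding airfoil_map_def by (simp add: mult.commute)
  qed
  then have d: "deriv (airfoil_map R) w = of_real R * (1 - 1 / T\<^sup>2) / 2"
    by (rule DERIV_imp_deriv)
  have *: "airfoil_map R w - joukowski \<zeta> = (T - \<zeta>) * (T - 1 / \<zeta>) / (2 * T)"
    unfolding airfoil_map_def joukowski_def T_def[symmetric] using T \<zeta> by (simp add: field_simps)
  have shift: "1 / (w - (c - of_real (1 - R)) / of_real R) = of_real R / (T - c)" for c
  proof -
    have "w - (c - of_real (1 - R)) / of_real R = (T - c) / of_real R"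
      using R by (simp add: T_def field_simps)
    then show ?thesis by simp
  qed
  define D where "D = (T - \<zeta>) * (T - 1 / \<zeta>)"
  have D: "D \<noteq> 0" "D = T\<^sup>2 - (\<zeta> + 1 / \<zeta>) * T + 1"
  proof -
    show "D \<noteq> 0" using T by (simp add: D_def)
    have "(T - \<zeta>) * (T - q) = T\<^sup>2 - (\<zeta> + q) * T + \<zeta> * q" for q
      by (simp add: power2_eq_square algebra_simps)
    then show "D = T\<^sup>2 - (\<zeta> + 1 / \<zeta>) * T + 1" using \<zeta> by (simp add: D_def)
  qed
  have "1 / (T - \<zeta>) + 1 / (T - 1 / \<zeta>) = (2 * T - (\<zeta> + 1 / \<zeta>)) / D"
    unfolding D_def using T by (subst add_frac_eq) (auto simp: algebra_simps)
  also have "\<dots> - 1 / T = ((2 * T - (\<zeta> + 1 / \<zeta>)) * T - D) / (D * T)"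
    using T D(1) by (simp add: diff_frac_eq)
  also have "(2 * T - (\<zeta> + 1 / \<zeta>)) * T - D = T\<^sup>2 - 1"
    unfolding D(2) by (simp add: power2_eq_square algebra_simps)
  also have "(T\<^sup>2 - 1) / (D * T) = (1 - 1 / T\<^sup>2) / (D / T)"
    using T D(1) by (simp add: field_simps power2_eq_square)
  finally have id: "(1 - 1 / T\<^sup>2) / ((T - \<zeta>) * (T - 1 / \<zeta>) / T) = 1 / (T - \<zeta>) + 1 / (T - 1 / \<zeta>) - 1 / T"
    unfolding D_def by simp
  have "deriv (airfoil_map R) w / (airfoil_map R w - joukowski \<zeta>)
      = of_real R * ((1 - 1 / T\<^sup>2) / ((T - \<zeta>) * (T - 1 / \<zeta>) / T))"
    unfolding d * by simp
  also have "\<dots> = of_real R / (T - \<zeta>) + of_real R / (T - 1 / \<zeta>) - of_real R / (T - 0)"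
    unfolding id by (simp add: algebra_simps)
  finally show ?thesis unfolding shift[symmetric] by simp
qed

lemma sums_geometric_at_infinity:
  fixes a w :: complex
  assumes "norm a < norm w"
  shows "(\<lambda>n. a ^ n / w ^ (n + 1)) sums (1 / (w - a))"
proof -
  have w: "w \<noteq> 0" using assms by auto
  have "norm (a / w) < 1" using assms w by (simp add: norm_divide)
  from sums_divide[OF geometric_sums[OF this], of w]
  have "(\<lambda>n. (a / w) ^ n / w) sums (1 / (1 - a / w) / w)" .
  moreover have "1 / (1 - a / w) / w = 1 / (w - a)"
  proof -
    have "w - a \<noteq> 0" using assms by auto
    then show ?thesis using w by (simp add: field_simps)
  qed
  ultimately show ?thesis by (simp add: power_divide mult.commute)
qed

text \<open>Each of the three simple fractions is a geometric series in \<open>1 / w\<close>, and coefficients of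
  power series are unique.\<close>

lemma faber_polynomial_joukowski:
  fixes R :: real
  assumes F: "faber_polynomials (airfoil_map R) F" and R: "R \<noteq> 0" and \<zeta>: "\<zeta> \<noteq> 0"
  shows "poly (F n) (joukowski \<zeta>) = ((\<zeta> - of_real (1 - R)) / of_real R) ^ n
           + ((1 / \<zeta> - of_real (1 - R)) / of_real R) ^ n - (- of_real (1 - R) / of_real R) ^ n"
proof -
  define p q r where "p = (\<zeta> - of_real (1 - R)) / complex_of_real R"
    and "q = (1 / \<zeta> - of_real (1 - R)) / complex_of_real R"
    and "r = - of_real (1 - R) / complex_of_real R"
  define d where "d n = poly (F n) (joukowski \<zeta>) - (p ^ n + q ^ n - r ^ n)" for n
  from F obtain M where M: "\<And>w. norm w \<ge> M \<Longrightarrow> (\<lambda>n. poly (F n) (joukowski \<zeta>) / w ^ (n + 1)) sums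
      (deriv (airfoil_map R) w / (airfoil_map R w - joukowski \<zeta>))"
    unfolding faber_polynomials_def eventually_at_infinity by blast
  \<comment> \<open>large enough for the defining expansion and for all three geometric series\<close>
  define N where "N = \<bar>M\<bar> + norm p + norm q + norm r + 1"
  have Npos: "N > 0" unfolding N_def by (smt (verit) norm_ge_zero)
  have sm: "(\<lambda>n. d n * t ^ n) sums 0" if t: "t \<noteq> 0" "norm t < 1 / N" for t
  proof -
    define w where "w = 1 / t"
    have w: "norm w > N" using t Npos by (simp add: w_def norm_divide field_simps)
    then have big: "norm w \<ge> M" "norm p < norm w" "norm q < norm w" "norm r < norm w"
      unfolding N_def by (smt (verit) norm_ge_zero)+
    have ne: "w \<noteq> p" "w \<noteq> q" "w \<noteq> r" using big by auto
    have "(\<lambda>n. p ^ n / w ^ (n + 1) + q ^ n / w ^ (n + 1) - r ^ n / w ^ (n + 1)) sums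
            (1 / (w - p) + 1 / (w - q) - 1 / (w - r))"
      by (intro sums_add sums_diff sums_geometric_at_infinity big)
    moreover have "deriv (airfoil_map R) w / (airfoil_map R w - joukowski \<zeta>)
        = 1 / (w - p) + 1 / (w - q) - 1 / (w - r)"
      unfolding p_def q_def r_def
      by (rule airfoil_log_deriv) (use ne R \<zeta> in \<open>auto simp: p_def q_def r_def field_simps\<close>)
    ultimately have "(\<lambda>n. poly (F n) (joukowski \<zeta>) / w ^ (n + 1) -
        (p ^ n / w ^ (n + 1) + q ^ n / w ^ (n + 1) - r ^ n / w ^ (n + 1))) sums 0"
      using sums_diff[OF M[OF big(1)]] by fastforce
    also have "(\<lambda>n. poly (F n) (joukowski \<zeta>) / w ^ (n + 1) -
        (p ^ n / w ^ (n + 1) + q ^ n / w ^ (n + 1) - r ^ n / w ^ (n + 1))) = (\<lambda>n. t * (d n * t ^ n))"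
      using t by (auto simp: fun_eq_iff w_def d_def field_simps)
    finally have "(\<lambda>n. t * (d n * t ^ n)) sums 0" .
    from sums_mult[OF this, of "1 / t"] show ?thesis using t by simp
  qed
  have "d n = 0" by (rule powser_eq_zero[of "1 / N"]) (use sm Npos in auto)
  then show ?thesis by (simp add: d_def p_def q_def r_def)
qed

text \<open>The root of \<open>joukowski \<zeta> = z\<close> outside the open unit disc.\<close>

definition outer_root :: "complex \<Rightarrow> complex" where
  "outer_root z = z + sqrt_cut z"

lemma sqrt_cut_squared: "(sqrt_cut z)\<^sup>2 = z\<^sup>2 - 1"
  by (simp add: sqrt_cut_def power_mult_distrib) (simp add: algebra_simps power2_eq_square)

lemma outer_root_mult: "outer_root z * (z - sqrt_cut z) = 1"
proof -
  have "outer_root z * (z - sqrt_cut z) = z\<^sup>2 - (sqrt_cut z)\<^sup>2"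
    unfolding outer_root_def by (simp add: algebra_simps power2_eq_square)
  then show ?thesis by (simp add: sqrt_cut_squared)
qed

lemma outer_root_nonzero [simp]: "outer_root z \<noteq> 0"
  using outer_root_mult[of z] by auto

lemma joukowski_outer_root [simp]: "joukowski (outer_root z) = z"
proof -
  have "1 / outer_root z = z - sqrt_cut z"
    using outer_root_mult[of z] by (simp add: field_simps)
  then show ?thesis unfolding joukowski_def by (simp add: outer_root_def)
qed

text \<open>Both square roots lie in the closed quadrant that belongs to the half plane of \<open>z\<close>.\<close>

lemma csqrt_shift_same_side: "Im (csqrt (z - 1)) * Im (csqrt (z + 1)) \<ge> 0"
proof (cases "Im z = 0")
  case True
  then have "Im (csqrt (z - 1)) \<ge> 0" "Im (csqrt (z + 1)) \<ge> 0"
    using complex_Re_le_cmod[of "z - 1"] complex_Re_le_cmod[of "z + 1"] by (auto simp: sgn_if)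
  then show ?thesis by simp
next
  case False
  then have "sgn (Im (csqrt (z - 1))) = sgn (Im z) \<or> Im (csqrt (z - 1)) = 0"
    "sgn (Im (csqrt (z + 1))) = sgn (Im z) \<or> Im (csqrt (z + 1)) = 0"
    using complex_Re_le_cmod[of "z - 1"] complex_Re_le_cmod[of "z + 1"] by (auto simp: sgn_mult sgn_if)
  then show ?thesis by (auto simp: sgn_if zero_le_mult_iff split: if_splits)
qed

text \<open>With \<open>p\<close> and \<open>q\<close> the two principal roots, the solutions \<open>z \<plusminus> p q\<close> are \<open>(p \<plusminus> q)\<^sup>2 / 2\<close>, and \<open>p\<close>, \<open>q\<close>
  enclose an angle of at most \<open>\<pi> / 2\<close>. So the solution with the plus sign has the larger modulus,
  and the product of both moduli is one.\<close>

lemma norm_outer_root_ge_1: "norm (outer_root z) \<ge> 1"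
proof -
  define p q where "p = csqrt (z - 1)" and "q = csqrt (z + 1)"
  have pq: "p\<^sup>2 = z - 1" "q\<^sup>2 = z + 1" by (simp_all add: p_def q_def)
  have s: "sqrt_cut z = p * q" by (simp add: sqrt_cut_def p_def q_def)
  have z: "z = (p\<^sup>2 + q\<^sup>2) / 2" by (simp add: pq)
  have o: "outer_root z = (p + q)\<^sup>2 / 2" "z - sqrt_cut z = (p - q)\<^sup>2 / 2"
    unfolding outer_root_def s using z by (simp_all add: power2_eq_square algebra_simps)
  have "Re p * Re q \<ge> 0" by (simp add: p_def q_def Re_csqrt del: csqrt.sel)
  moreover have "Im p * Im q \<ge> 0" unfolding p_def q_def by (rule csqrt_shift_same_side)
  ultimately have "(norm (p - q))\<^sup>2 \<le> (norm (p + q))\<^sup>2"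
    unfolding cmod_power2 by (simp add: power2_eq_square algebra_simps)
  then have le: "norm (z - sqrt_cut z) \<le> norm (outer_root z)"
    unfolding o by (simp add: norm_divide norm_power)
  have "norm (outer_root z) * norm (z - sqrt_cut z) = 1"
    using outer_root_mult[of z] by (metis norm_mult norm_one)
  then show ?thesis using le
    using mult_strict_mono[of "norm (outer_root z)" 1 "norm (z - sqrt_cut z)" 1]
    by (cases "norm (outer_root z) < 1") auto
qed

lemma outer_root_joukowski:
  assumes "norm \<zeta> > 1"
  shows "outer_root (joukowski \<zeta>) = \<zeta>"
proof -
  have "\<zeta> \<noteq> 0" using assms by auto
  then have "outer_root (joukowski \<zeta>) = \<zeta> \<or> outer_root (joukowski \<zeta>) = 1 / \<zeta>"
    by (intro joukowski_eq_imp) auto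
  moreover have "norm (1 / \<zeta>) < 1" 
    using order.strict_trans[OF zero_less_one assms] assms
    by (simp only: norm_divide norm_one divide_less_eq_1_pos)
  ultimately show ?thesis using norm_outer_root_ge_1[of "joukowski \<zeta>"] by auto
qed

lemma joukowski_unit_circle:
  assumes "norm \<zeta> = 1"
  shows "joukowski \<zeta> = of_real (Re \<zeta>)"
proof -
  have "1 / \<zeta> = cnj \<zeta>" using assms by (metis complex_div_cnj div_by_1 mult_1 of_real_1 one_power2)
  then show ?thesis unfolding joukowski_def by (simp add: complex_eq_iff)
qed

lemma joukowski_mem_interval_imp_unit:
  assumes "\<zeta> \<noteq> 0" "joukowski \<zeta> = of_real x" "\<bar>x\<bar> \<le> 1"
  shows "norm \<zeta> = 1"
proof -
  define \<xi> where "\<xi> = Complex x (sqrt (1 - x\<^sup>2))"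
  have x: "x\<^sup>2 \<le> 1" using assms(3) by (simp add: abs_square_le_1)
  then have n: "norm \<xi> = 1" by (simp add: \<xi>_def cmod_def)
  then have "joukowski \<xi> = joukowski \<zeta>" "\<xi> \<noteq> 0"
    using joukowski_unit_circle[OF n] assms by (auto simp: \<xi>_def)
  then have "\<zeta> = \<xi> \<or> \<zeta> = 1 / \<xi>" using joukowski_eq_imp[of \<zeta> \<xi>] assms by auto
  then show ?thesis using n by (auto simp: norm_divide)
qed

lemma phi_eq_outer_root: "b \<noteq> 0 \<Longrightarrow> phi b z = 1 - outer_root z / of_real b"
  by (simp add: phi_def outer_root_def field_simps)

text \<open>The second factor as a function of the first: if \<open>u = 1 - \<zeta> / b\<close>, this is \<open>1 - 1 / (b \<zeta>)\<close>.\<close>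

definition inner_factor :: "real \<Rightarrow> complex \<Rightarrow> complex" where
  "inner_factor b u = 1 + 1 / ((of_real b)\<^sup>2 * (u - 1))"

text \<open>Dividing the explicit formula by \<open>(- b / R)\<^sup>n\<close> leaves an equation in which \<open>n\<close> occurs only as an
  exponent.\<close>

lemma faber_zero_iff:
  fixes R b :: real
  assumes F: "faber_polynomials (airfoil_map R) F" and b: "b = 1 - R" "R \<noteq> 0" "b \<noteq> 0" and u: "u \<noteq> 1"
  shows "poly (F n) (joukowski (of_real b * (1 - u))) = 0 \<longleftrightarrow> u ^ n + inner_factor b u ^ n = 1"
proof -
  define c where "c = - complex_of_real b / of_real R"
  define \<zeta> where "\<zeta> = of_real b * (1 - u)"
  have \<zeta>: "\<zeta> \<noteq> 0" using b u by (simp add: \<zeta>_def)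
  have c: "c \<noteq> 0" using b by (simp add: c_def)
  have 1: "(\<zeta> - of_real b) / of_real R = c * u"
    using b by (simp add: \<zeta>_def c_def field_simps)
  have "1 - u \<noteq> 0" "u - 1 \<noteq> 0" using u by auto
  then have "1 / \<zeta> - of_real b = - of_real b * inner_factor b u"
    using b(3) unfolding \<zeta>_def inner_factor_def by (simp add: divide_simps power2_eq_square) (simp add: algebra_simps)
  then have 2: "(1 / \<zeta> - of_real b) / of_real R = c * inner_factor b u"
    by (simp add: c_def)
  have "poly (F n) (joukowski \<zeta>) = (c * u) ^ n + (c * inner_factor b u) ^ n - c ^ n"
    using faber_polynomial_joukowski[OF F b(2) \<zeta>, of n] unfolding b(1)[symmetric] 1 2 by (simp add: c_def)
  also have "\<dots> = c ^ n * (u ^ n + inner_factor b u ^ n - 1)"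
    by (simp add: power_mult_distrib algebra_simps)
  finally show ?thesis using c by (simp add: \<zeta>_def)
qed

section \<open>Degree, and accumulation of the zeros\<close>

text \<open>The power sums of \<open>\<zeta> - c\<close> and \<open>1 / \<zeta> - c\<close> as polynomials in \<open>joukowski \<zeta>\<close>, by Newton's recursion: the
  sum of the two numbers is \<open>2 z - 2 c\<close>, their product \<open>1 + c\<^sup>2 - 2 c z\<close>.\<close>

fun shifted_power_sum :: "complex \<Rightarrow> nat \<Rightarrow> complex poly" where
  "shifted_power_sum c 0 = [:2:]"
| "shifted_power_sum c (Suc 0) = [:- 2 * c, 2:]"
| "shifted_power_sum c (Suc (Suc n)) =
     [:- 2 * c, 2:] * shifted_power_sum c (Suc n) - [:1 + c\<^sup>2, - 2 * c:] * shifted_power_sum c n"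

lemma poly_shifted_power_sum:
  assumes "\<zeta> \<noteq> 0"
  shows "poly (shifted_power_sum c n) (joukowski \<zeta>) = (\<zeta> - c) ^ n + (1 / \<zeta> - c) ^ n"
proof (induction c n rule: shifted_power_sum.induct)
  case (2 c)
  then show ?case using assms by (simp add: joukowski_def algebra_simps)
next
  case (3 c n)
  define p q where "p = \<zeta> - c" and "q = 1 / \<zeta> - c"
  have s: "- 2 * c + 2 * joukowski \<zeta> = p + q"
    by (simp add: joukowski_def p_def q_def algebra_simps)
  have t: "1 + c\<^sup>2 - 2 * c * joukowski \<zeta> = p * q"
  proof -
    have "1 + c\<^sup>2 - c * (\<zeta> + \<xi>) = (\<zeta> - c) * (\<xi> - c)" if "\<zeta> * \<xi> = 1" for \<xi>
      using that by (simp add: power2_eq_square algebra_simps)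
    from this[of "1 / \<zeta>"] show ?thesis
      using assms by (simp add: joukowski_def p_def q_def)
  qed
  have "poly (shifted_power_sum c (Suc (Suc n))) (joukowski \<zeta>)
      = (- 2 * c + 2 * joukowski \<zeta>) * poly (shifted_power_sum c (Suc n)) (joukowski \<zeta>)
        - (1 + c\<^sup>2 - 2 * c * joukowski \<zeta>) * poly (shifted_power_sum c n) (joukowski \<zeta>)"
    by (simp add: algebra_simps)
  also have "\<dots> = (p + q) * (p ^ Suc n + q ^ Suc n) - (p * q) * (p ^ n + q ^ n)"
    unfolding s t 3 p_def q_def ..
  also have "\<dots> = p ^ Suc (Suc n) + q ^ Suc (Suc n)"
    by (simp add: algebra_simps)
  finally show ?case by (simp add: p_def q_def)
qed auto

lemma degree_shifted_power_sum: "degree (shifted_power_sum c n) \<le> n"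
proof (induction c n rule: shifted_power_sum.induct)
  case (3 c n)
  have "degree ([:- 2 * c, 2:] * shifted_power_sum c (Suc n)) \<le> 1 + Suc n"
    using degree_mult_le[of "[:- 2 * c, 2:]" "shifted_power_sum c (Suc n)"] 3(1) by simp
  moreover have "degree ([:1 + c\<^sup>2, - 2 * c:] * shifted_power_sum c n) \<le> 1 + n"
  proof -
    have "degree [:1 + c\<^sup>2, - 2 * c:] \<le> 1" by simp
    then show ?thesis
      using degree_mult_le[of "[:1 + c\<^sup>2, - 2 * c:]" "shifted_power_sum c n"] 3(2) by linarith
  qed
  ultimately show ?case by (simp only: shifted_power_sum.simps) (rule degree_diff_le, auto)
qed auto

lemma degree_faber_polynomial_le:
  fixes R :: real
  assumes F: "faber_polynomials (airfoil_map R) F" and R: "R \<noteq> 0"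
  shows "degree (F n) \<le> n"
proof -
  define c where "c = complex_of_real (1 - R)"
  have "F n = smult (1 / of_real R ^ n) (shifted_power_sum c n - [:(- c) ^ n:])"
  proof (rule poly_eq_poly_eq_iff[THEN iffD1], rule ext)
    fix z
    have "poly (F n) (joukowski (outer_root z)) =
        poly (smult (1 / of_real R ^ n) (shifted_power_sum c n - [:(- c) ^ n:])) (joukowski (outer_root z))"
      unfolding faber_polynomial_joukowski[OF F R outer_root_nonzero] poly_smult poly_diff
        poly_shifted_power_sum[OF outer_root_nonzero] c_def[symmetric] power_divide
      using R by (simp add: diff_divide_distrib add_divide_distrib)
    then show "poly (F n) z = poly (smult (1 / of_real R ^ n) (shifted_power_sum c n - [:(- c) ^ n:])) z"
      by simp
  qed
  moreover have "degree (shifted_power_sum c n - [:(- c) ^ n:]) \<le> n"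
    by (rule degree_diff_le) (auto simp: degree_shifted_power_sum)
  ultimately show ?thesis using degree_smult_le le_trans by metis
qed

text \<open>At \<open>z = 1\<close> both factors equal \<open>1 - 1 / b > 1\<close>, so the sum of their powers exceeds one.\<close>

lemma faber_polynomial_nonzero:
  fixes R b :: real
  assumes F: "faber_polynomials (airfoil_map R) F" and b: "b = 1 - R" "R \<noteq> 0" "b < 0"
  shows "F n \<noteq> 0"
proof
  assume "F n = 0"
  define u where "u = 1 - 1 / complex_of_real b"
  have u: "u \<noteq> 1" "u = of_real (1 - 1 / b)" using b by (simp_all add: u_def)
  have iu: "inner_factor b u = u" using b(3) by (simp add: inner_factor_def u_def power2_eq_square)
  have "poly (F n) (joukowski (of_real b * (1 - u))) = 0" using \<open>F n = 0\<close> by simp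
  then have "u ^ n + u ^ n = 1"
    using faber_zero_iff[OF F b(1,2) _ u(1), of n] b(3) iu by simp
  then have "of_real ((1 - 1 / b) ^ n + (1 - 1 / b) ^ n) = complex_of_real 1" unfolding u(2) by simp
  then have "(1 - 1 / b) ^ n + (1 - 1 / b) ^ n = 1" by (simp only: of_real_eq_iff)
  moreover have "(1 - 1 / b) ^ n \<ge> 1" using b(3) by (intro one_le_power) (simp add: field_simps)
  ultimately show False by simp
qed

lemma tendsto_power_zero_seq:
  fixes q :: "nat \<Rightarrow> complex"
  assumes q: "q \<longlonglongrightarrow> Q" "norm Q < 1" and r: "strict_mono r"
  shows "(\<lambda>k. q k ^ r k) \<longlonglongrightarrow> 0"
proof -
  obtain \<rho> where \<rho>: "norm Q < \<rho>" "\<rho> < 1" using dense q(2) by blast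
  then have \<rho>0: "\<rho> \<ge> 0" by (smt (verit) norm_ge_zero)
  have "\<forall>\<^sub>F k in sequentially. norm (q k) < \<rho>"
    using tendsto_norm[OF q(1)] \<rho>(1) by (rule order_tendstoD)
  then have "\<forall>\<^sub>F k in sequentially. norm (q k ^ r k) \<le> \<rho> ^ r k"
    by eventually_elim (auto simp: norm_power intro!: power_mono)
  moreover have "(\<lambda>k. \<rho> ^ r k) \<longlonglongrightarrow> 0"
    using LIMSEQ_subseq_LIMSEQ[OF LIMSEQ_power_zero[of \<rho>] r] \<rho> \<rho>0 by (simp add: o_def)
  ultimately show ?thesis by (rule Lim_null_comparison)
qed

text \<open>After division by \<open>u\<^sup>n\<close> the equation would read \<open>1 = 0\<close> in the limit.\<close>

lemma no_dominant_term:
  fixes u v :: "nat \<Rightarrow> complex"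
  assumes u: "u \<longlonglongrightarrow> U" and v: "v \<longlonglongrightarrow> V" and r: "strict_mono r"
    and eq: "\<And>k. u k ^ r k + v k ^ r k = 1"
  shows "\<not> (norm V < norm U \<and> 1 < norm U)"
proof
  assume dom: "norm V < norm U \<and> 1 < norm U"
  then have U: "U \<noteq> 0" by auto
  have vu: "(\<lambda>k. (v k / u k) ^ r k) \<longlonglongrightarrow> 0"
    by (rule tendsto_power_zero_seq[OF tendsto_divide[OF v u U] _ r])
       (use dom U in \<open>auto simp: norm_divide divide_less_eq\<close>)
  have iu: "(\<lambda>k. (1 / u k) ^ r k) \<longlonglongrightarrow> 0"
    by (rule tendsto_power_zero_seq[OF tendsto_divide[OF tendsto_const u U] _ r])
       (use dom U in \<open>auto simp: norm_divide divide_less_eq\<close>)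
  have "\<forall>\<^sub>F k in sequentially. u k \<noteq> 0" using u U by (rule tendsto_imp_eventually_ne)
  then have "\<forall>\<^sub>F k in sequentially. 1 + (v k / u k) ^ r k = (1 / u k) ^ r k"
  proof eventually_elim
    case (elim k)
    then have "1 + (v k / u k) ^ r k = (u k ^ r k + v k ^ r k) / u k ^ r k"
      by (simp add: power_divide add_divide_distrib)
    then show ?case unfolding eq by (simp add: power_divide)
  qed
  then have "(\<lambda>k. 1 + (v k / u k) ^ r k) \<longlonglongrightarrow> 0"
    using iu by (simp add: filterlim_cong)
  moreover have "(\<lambda>k. 1 + (v k / u k) ^ r k) \<longlonglongrightarrow> 1 + 0" by (intro tendsto_intros vu)
  ultimately show False using LIMSEQ_unique by fastforce
qed

lemma limiting_tie:
  fixes u v :: "nat \<Rightarrow> complex"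
  assumes u: "u \<longlonglongrightarrow> U" and v: "v \<longlonglongrightarrow> V" and r: "strict_mono r"
    and eq: "\<And>k. u k ^ r k + v k ^ r k = 1"
  shows "norm U = norm V \<and> norm U \<ge> 1 \<or> norm U = 1 \<and> norm V \<le> 1 \<or> norm V = 1 \<and> norm U \<le> 1"
proof -
  have "\<not> (norm V < norm U \<and> 1 < norm U)" by (rule no_dominant_term[OF u v r eq])
  moreover have "\<not> (norm U < norm V \<and> 1 < norm V)"
    by (rule no_dominant_term[OF v u r]) (use eq in \<open>simp add: add.commute\<close>)
  moreover have "\<not> (norm U < 1 \<and> norm V < 1)"
  proof
    assume "norm U < 1 \<and> norm V < 1"
    then have "(\<lambda>k. u k ^ r k + v k ^ r k) \<longlonglongrightarrow> 0 + 0"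
      by (intro tendsto_intros tendsto_power_zero_seq[OF u _ r] tendsto_power_zero_seq[OF v _ r]) auto
    then show False unfolding eq by (simp add: LIMSEQ_const_iff)
  qed
  ultimately show ?thesis by linarith
qed

lemma norm_one_minus_divide_squared:
  assumes "b \<noteq> 0"
  shows "(norm (1 - \<zeta> / complex_of_real b))\<^sup>2 * b\<^sup>2 = b\<^sup>2 - 2 * b * Re \<zeta> + (norm \<zeta>)\<^sup>2"
proof -
  have "(norm (1 - \<zeta> / complex_of_real b))\<^sup>2 * b\<^sup>2 = (norm ((1 - \<zeta> / complex_of_real b) * of_real b))\<^sup>2"
    by (simp add: norm_mult power_mult_distrib)
  also have "(1 - \<zeta> / complex_of_real b) * of_real b = of_real b - \<zeta>"
    using assms by (simp add: field_simps)
  also have "(norm (of_real b - \<zeta>))\<^sup>2 = b\<^sup>2 - 2 * b * Re \<zeta> + (norm \<zeta>)\<^sup>2"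
    unfolding cmod_power2 by (simp add: power2_eq_square algebra_simps)
  finally show ?thesis .
qed

lemma norm_inner_squared:
  assumes "b \<noteq> 0" "\<zeta> \<noteq> 0"
  shows "(norm (1 - 1 / (complex_of_real b * \<zeta>)))\<^sup>2 * b\<^sup>2 * (norm \<zeta>)\<^sup>2 = b\<^sup>2 * (norm \<zeta>)\<^sup>2 - 2 * b * Re \<zeta> + 1"
proof -
  have "Re (1 / \<zeta>) * (norm \<zeta>)\<^sup>2 = Re \<zeta>"
    using assms by (simp add: Re_divide cmod_power2)
  moreover have "norm (1 / \<zeta>) ^ 2 * (norm \<zeta>)\<^sup>2 = 1" using assms by (simp add: norm_divide power_divide)
  moreover have "(norm (1 - (1 / \<zeta>) / complex_of_real b))\<^sup>2 * b\<^sup>2 * (norm \<zeta>)\<^sup>2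
      = b\<^sup>2 * (norm \<zeta>)\<^sup>2 - 2 * b * (Re (1 / \<zeta>) * (norm \<zeta>)\<^sup>2) + norm (1 / \<zeta>) ^ 2 * (norm \<zeta>)\<^sup>2"
    unfolding norm_one_minus_divide_squared[OF assms(1)] by (simp only: algebra_simps)
  ultimately show ?thesis by (simp add: mult.commute)
qed

text \<open>For \<open>|l| > 1\<close> the condition \<open>|U| = |V|\<close> forces \<open>b\<^sup>2 |U|\<^sup>2 = b\<^sup>2 - 1\<close>, and \<open>|V| = 1\<close> forces
  \<open>b\<^sup>2 |U|\<^sup>2 = b\<^sup>2 - 1 + |l|\<^sup>2\<close>. Neither is compatible with the accompanying inequality, so off the cut
  only \<open>|U| = 1\<close> remains.\<close>

lemma tie_location:
  assumes b: "b < 0" and l: "norm l \<ge> 1"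
    and U: "U = 1 - l / complex_of_real b" and V: "V = 1 - 1 / (complex_of_real b * l)"
    and tie: "norm U = norm V \<and> norm U \<ge> 1 \<or> norm U = 1 \<and> norm V \<le> 1 \<or> norm V = 1 \<and> norm U \<le> 1"
  shows "joukowski l \<in> loop_L b \<union> of_real ` interval_I b"
proof -
  define x s where "x = Re l" and "s = (norm l)\<^sup>2"
  have b0: "b \<noteq> 0" "b\<^sup>2 > 0" and l0: "l \<noteq> 0" using b l by auto
  have s1: "s \<ge> 1" using l unfolding s_def by (rule one_le_power)
  have nU: "(norm U)\<^sup>2 * b\<^sup>2 = b\<^sup>2 - 2 * b * x + s"
    unfolding U x_def s_def by (rule norm_one_minus_divide_squared[OF b0(1)])
  have nV: "(norm V)\<^sup>2 * b\<^sup>2 * s = b\<^sup>2 * s - 2 * b * x + 1"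
    unfolding V x_def s_def by (rule norm_inner_squared[OF b0(1) l0])
  show ?thesis
  proof (cases "norm l = 1")
    case True
    then have s: "s = 1" by (simp add: s_def)
    then have "(norm U)\<^sup>2 * b\<^sup>2 = (norm V)\<^sup>2 * b\<^sup>2" using nU nV by simp
    then have "norm U = norm V" using b0 by simp
    then have "norm U \<ge> 1" using tie by auto
    then have "(norm U)\<^sup>2 * b\<^sup>2 \<ge> 1 * b\<^sup>2" by (intro mult_right_mono one_le_power) auto
    then have "2 * b * x \<le> 1" using nU s by simp
    then have "1 / (2 * b) \<le> x" using b by (simp add: field_simps)
    moreover have "x \<le> 1" unfolding x_def using complex_Re_le_cmod[of l] True by simp
    ultimately have "of_real x \<in> complex_of_real ` interval_I b" by (simp add: interval_I_def)
    then show ?thesis using joukowski_unit_circle[OF True] by (simp add: x_def)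
  next
    case False
    then have l1: "norm l > 1" using l by simp
    then have s1: "s > 1" unfolding s_def by (simp add: one_less_power)
    have off: "joukowski l \<notin> of_real ` {-1..1}"
      using joukowski_mem_interval_imp_unit[OF l0] False by force
    have phi: "phi b (joukowski l) = U"
      using phi_eq_outer_root[OF b0(1)] outer_root_joukowski[OF l1] U by simp
    have "norm U = 1"
    proof (rule ccontr)
      assume "norm U \<noteq> 1"
      then consider "norm U = norm V" "norm U \<ge> 1" | "norm V = 1" "norm U \<le> 1" using tie by auto
      then show False
      proof cases
        case 1
        have "(b\<^sup>2 - 2 * b * x + s) * s = b\<^sup>2 * s - 2 * b * x + 1"
          using nU nV 1(1) by metis
        then have "(s - 1) * (1 + s - 2 * b * x) = 0" by (simp add: algebra_simps)
        then have "- 2 * b * x + s = - 1" using s1 by simp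
        moreover have "(norm U)\<^sup>2 * b\<^sup>2 \<ge> 1 * b\<^sup>2" using 1(2) by (intro mult_right_mono one_le_power) auto
        ultimately show False using nU by simp
      next
        case 2
        then have "- 2 * b * x + 1 = 0" using nV by simp
        moreover have "(norm U)\<^sup>2 * b\<^sup>2 \<le> 1 * b\<^sup>2" using 2(2) by (intro mult_right_mono power_le_one) auto
        ultimately show False using nU s1 by simp
      qed
    qed
    then show ?thesis using off phi unfolding loop_L_def by simp
  qed
qed

lemma inner_factor_outer:
  assumes "b \<noteq> 0" "\<zeta> \<noteq> 0"
  shows "inner_factor b (1 - \<zeta> / of_real b) = 1 - 1 / (of_real b * \<zeta>)"
  using assms by (simp add: inner_factor_def power2_eq_square)

lemma faber_zero_outer_root:
  fixes R b :: real
  assumes F: "faber_polynomials (airfoil_map R) F" and b: "b = 1 - R" "R \<noteq> 0" "b \<noteq> 0"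
    and z: "poly (F n) z = 0"
  shows "(1 - outer_root z / of_real b) ^ n + (1 - 1 / (of_real b * outer_root z)) ^ n = 1"
proof -
  define u where "u = 1 - outer_root z / complex_of_real b"
  have "u \<noteq> 1" "of_real b * (1 - u) = outer_root z" using b by (simp_all add: u_def)
  then show ?thesis
    using faber_zero_iff[OF F b, of u n] z inner_factor_outer[of b "outer_root z"] b(3)
    by (simp add: u_def)
qed

text \<open>Since \<open>|\<zeta>| \<ge> 1\<close>, the second factor is bounded by \<open>V = 1 - 1 / b\<close>. Then \<open>|u|\<^sup>n \<le> 1 + V\<^sup>n \<le> (2 V)\<^sup>n\<close>
  bounds the first.\<close>

lemma faber_zero_bounded:
  fixes R b :: real
  assumes F: "faber_polynomials (airfoil_map R) F" and b: "b = 1 - R" "R \<noteq> 0" "b < 0"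
    and z: "poly (F n) z = 0" and n: "n > 0"
  shows "norm (outer_root z) \<le> - b * (3 + 2 * (1 - 1 / b))"
proof -
  define \<zeta> where "\<zeta> = outer_root z"
  define u v where "u = 1 - \<zeta> / complex_of_real b" and "v = 1 - 1 / (complex_of_real b * \<zeta>)"
  define V where "V = 1 - 1 / b"
  have V1: "V \<ge> 1" using b(3) by (simp add: V_def)
  have \<zeta>: "norm \<zeta> \<ge> 1" unfolding \<zeta>_def by (rule norm_outer_root_ge_1)
  have "norm (1 / (complex_of_real b * \<zeta>)) = 1 / (- b * norm \<zeta>)"
    using b(3) by (simp add: norm_divide norm_mult)
  also have "\<dots> \<le> 1 / - b"
    using b(3) \<zeta> by (intro frac_le) (auto simp: mult_le_cancel_left)
  finally have "norm v \<le> V" unfolding v_def V_def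
    using norm_triangle_ineq4[of 1 "1 / (complex_of_real b * \<zeta>)"] by simp
  then have vn: "norm (v ^ n) \<le> V ^ n" by (simp add: norm_power power_mono)
  have "u ^ n = 1 - v ^ n"
    using faber_zero_outer_root[OF F b(1,2) _ z] b(3) unfolding u_def v_def \<zeta>_def
    by (simp add: algebra_simps)
  then have "norm (u ^ n) \<le> 1 + V ^ n" using norm_triangle_ineq4[of 1 "v ^ n"] vn by simp
  also have "\<dots> \<le> 2 * V ^ n" using one_le_power[OF V1, of n] by simp
  also have "\<dots> \<le> 2 ^ n * V ^ n" using V1 n
    by (intro mult_right_mono) (auto intro: self_le_power)
  finally have "norm u ^ n \<le> (2 * V) ^ n" by (simp add: norm_power power_mult_distrib)
  then have "norm u \<le> 2 * V" using power_mono_iff[of "norm u" "2 * V" n] V1 n by simp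
  moreover have "\<zeta> = of_real b * (1 - u)" using b by (simp add: u_def)
  then have "norm \<zeta> = - b * norm (1 - u)" using b(3) by (simp add: norm_mult)
  moreover have "norm (1 - u) \<le> 1 + norm u" using norm_triangle_ineq4[of 1 u] by simp
  ultimately have "norm \<zeta> \<le> - b * (3 + 2 * V)"
    using b(3) by (smt (verit) mult_left_mono)
  then show ?thesis by (simp add: \<zeta>_def V_def)
qed

proposition zeros_accumulate:
  fixes R b :: real
  assumes F: "faber_polynomials (airfoil_map R) F" and b: "b = 1 - R" "R \<noteq> 0" "b < 0"
    and N: "open N" "loop_L b \<union> of_real ` interval_I b \<subseteq> N"
  shows "\<forall>\<^sub>F n in sequentially. \<forall>z. poly (F n) z = 0 \<longrightarrow> z \<in> N"
proof (rule ccontr)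
  have b0: "b \<noteq> 0" using b by simp
  define P where "P n \<longleftrightarrow> (\<exists>z. poly (F n) z = 0 \<and> z \<notin> N)" for n
  assume "\<not> ?thesis"
  then have inf: "\<exists>n\<ge>m. P n" for m
    unfolding eventually_sequentially P_def by blast
  then have "infinite {n. P n}" unfolding infinite_nat_iff_unbounded_le by blast
  then obtain r :: "nat \<Rightarrow> nat" where r: "strict_mono r" "\<And>k. P (r k)"
    using infinite_enumerate by blast
  then obtain z where z: "\<And>k. poly (F (r k)) (z k) = 0" "\<And>k. z k \<notin> N"
    unfolding P_def by metis
  \<comment> \<open>the shift to \<open>Suc k\<close> makes the index \<open>r (Suc k)\<close> positive, as the bound on zeros needs\<close>
  define \<zeta> where "\<zeta> k = outer_root (z (Suc k))" for k
  define M where "M = - b * (3 + 2 * (1 - 1 / b))"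
  have "\<zeta> k \<in> cball 0 M - ball 0 1" for k
  proof -
    have "r (Suc k) > 0" using seq_suble[OF r(1), of "Suc k"] by simp
    then have "norm (\<zeta> k) \<le> M" unfolding \<zeta>_def M_def by (rule faber_zero_bounded[OF F b z(1)])
    then show ?thesis using norm_outer_root_ge_1[of "z (Suc k)"] by (simp add: \<zeta>_def)
  qed
  moreover have "compact (cball 0 M - ball (0 :: complex) 1)" by (intro compact_diff) auto
  ultimately obtain l s where l: "l \<in> cball 0 M - ball (0 :: complex) 1"
    and s: "strict_mono s" "(\<zeta> \<circ> s) \<longlonglongrightarrow> l"
    using compact_imp_seq_compact seq_compactE by metis
  have l1: "norm l \<ge> 1" using l by auto
  then have l0: "l \<noteq> 0" by auto
  define r' where "r' k = r (Suc (s k))" for k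
  have r': "strict_mono r'" using r(1) s(1) unfolding r'_def strict_mono_def by auto
  have lim: "(\<lambda>k. \<zeta> (s k)) \<longlonglongrightarrow> l" using s(2) by (simp add: o_def)
  have u: "(\<lambda>k. 1 - \<zeta> (s k) / of_real b) \<longlonglongrightarrow> 1 - l / of_real b"
    by (intro tendsto_intros lim) (use b0 in auto)
  have v: "(\<lambda>k. 1 - 1 / (of_real b * \<zeta> (s k))) \<longlonglongrightarrow> 1 - 1 / (of_real b * l)"
    by (intro tendsto_intros lim) (use b0 l0 in auto)
  have eq: "(1 - \<zeta> (s k) / of_real b) ^ r' k + (1 - 1 / (of_real b * \<zeta> (s k))) ^ r' k = 1" for k
    unfolding \<zeta>_def r'_def by (rule faber_zero_outer_root[OF F b(1,2) b0 z(1)])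
  have "joukowski l \<in> N"
    using tie_location[OF b(3) l1 refl refl limiting_tie[OF u v r' eq]] N(2) by blast
  moreover have "(\<lambda>k. joukowski (\<zeta> (s k))) \<longlonglongrightarrow> joukowski l"
    unfolding joukowski_def by (intro tendsto_intros lim l0) auto
  then have "(\<lambda>k. z (Suc (s k))) \<longlonglongrightarrow> joukowski l" by (simp add: \<zeta>_def)
  ultimately have "\<forall>\<^sub>F k in sequentially. z (Suc (s k)) \<in> N"
    using N(1) topological_tendstoD by blast
  then show False using z(2) by (simp add: eventually_False)
qed

section \<open>The loop and the interval\<close>

lemma tendsto_csqrt_nonneg:
  assumes "y \<ge> 0"
  shows "(csqrt \<longlongrightarrow> of_real (sqrt y)) (at (complex_of_real y))"
proof (cases "y = 0")
  case True
  have "((\<lambda>z::complex. sqrt (norm z)) \<longlongrightarrow> sqrt 0) (at 0)"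
    by (intro tendsto_real_sqrt tendsto_norm_zero tendsto_ident_at)
  then have "((\<lambda>z. norm (csqrt z)) \<longlongrightarrow> 0) (at 0)" by (simp add: norm_csqrt)
  then have "(csqrt \<longlongrightarrow> 0) (at 0)" by (rule tendsto_norm_zero_cancel)
  then show ?thesis using True by simp
next
  case False
  then have "isCont csqrt (complex_of_real y)"
    using assms by (intro continuous_at_csqrt) (auto simp: complex_nonpos_Reals_iff)
  then show ?thesis using assms by (simp add: isCont_def csqrt_of_real)
qed

lemma tendsto_csqrt_one_minus:
  assumes "x \<le> 1"
  shows "((\<lambda>z. csqrt (1 - z)) \<longlongrightarrow> of_real (sqrt (1 - x))) (at (complex_of_real x))"
proof -
  have "((\<lambda>z. 1 - z) \<longlongrightarrow> complex_of_real (1 - x)) (at (complex_of_real x))"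
    by (auto intro!: tendsto_eq_intros)
  moreover have "\<forall>\<^sub>F z in at (complex_of_real x). 1 - z \<noteq> of_real (1 - x)"
    using eventually_neq_at_within[of "complex_of_real x" "complex_of_real x" UNIV] by eventually_elim auto
  ultimately show ?thesis
    using assms by (intro filterlim_compose[OF tendsto_csqrt_nonneg]) (auto simp: filterlim_at)
qed

lemma tendsto_csqrt_plus_one:
  assumes "x \<ge> -1"
  shows "((\<lambda>z. csqrt (z + 1)) \<longlongrightarrow> of_real (sqrt (1 + x))) (at (complex_of_real x))"
proof -
  have "((\<lambda>z. z + 1) \<longlongrightarrow> complex_of_real (1 + x)) (at (complex_of_real x))"
    by (auto intro!: tendsto_eq_intros)
  moreover have "\<forall>\<^sub>F z in at (complex_of_real x). z + 1 \<noteq> of_real (1 + x)"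
    using eventually_neq_at_within[of "complex_of_real x" "complex_of_real x" UNIV] by eventually_elim auto
  ultimately show ?thesis
    using assms by (intro filterlim_compose[OF tendsto_csqrt_nonneg]) (auto simp: filterlim_at)
qed

lemma at_within_half_planes_nontrivial:
  "at (complex_of_real x) within {z. Im z > 0} \<noteq> bot"
  "at (complex_of_real x) within {z. Im z < 0} \<noteq> bot"
proof -
  have "complex_of_real x islimpt {z. Im z > 0}"
    unfolding islimpt_approachable
  proof (intro allI impI)
    fix e :: real assume "e > 0"
    then show "\<exists>x'\<in>{z. 0 < Im z}. x' \<noteq> complex_of_real x \<and> dist x' (complex_of_real x) < e"
      by (intro bexI[of _ "Complex x (e / 2)"]) (auto simp: dist_norm cmod_def complex_eq_iff)
  qed
  moreover have "complex_of_real x islimpt {z. Im z < 0}"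
    unfolding islimpt_approachable
  proof (intro allI impI)
    fix e :: real assume "e > 0"
    then show "\<exists>x'\<in>{z. Im z < 0}. x' \<noteq> complex_of_real x \<and> dist x' (complex_of_real x) < e"
      by (intro bexI[of _ "Complex x (- e / 2)"]) (auto simp: dist_norm cmod_def complex_eq_iff)
  qed
  ultimately show "at (complex_of_real x) within {z. Im z > 0} \<noteq> bot"
    "at (complex_of_real x) within {z. Im z < 0} \<noteq> bot"
    by (auto simp: trivial_limit_within)
qed

lemma sqrt_factor: "\<bar>x\<bar> \<le> 1 \<Longrightarrow> sqrt (1 - x) * sqrt (1 + x) = sqrt (1 - x\<^sup>2)"
  by (simp add: real_sqrt_mult[symmetric] algebra_simps power2_eq_square)

text \<open>For \<open>Im z > 0\<close> the identity \<open>csqrt (z - 1) = \<i> csqrt (1 - z)\<close> moves the first square root off its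
  branch cut.\<close>

lemma phi_plus_eq:
  assumes "\<bar>x\<bar> \<le> 1" "b \<noteq> 0"
  shows "phi_plus b x = 1 - Complex x (sqrt (1 - x\<^sup>2)) / of_real b"
proof -
  let ?F = "at (complex_of_real x) within {z. Im z > 0}"
  have "((\<lambda>z. \<i> * csqrt (1 - z) * csqrt (z + 1)) \<longlongrightarrow>
      \<i> * of_real (sqrt (1 - x)) * of_real (sqrt (1 + x))) ?F"
    using assms by (intro tendsto_intros tendsto_within_subset[OF tendsto_csqrt_one_minus]
        tendsto_within_subset[OF tendsto_csqrt_plus_one]) auto
  moreover have "\<forall>\<^sub>F z in ?F. \<i> * csqrt (1 - z) * csqrt (z + 1) = sqrt_cut z"
    unfolding eventually_at_filter
  proof (intro always_eventually allI impI)
    fix z :: complex assume "z \<in> {z. Im z > 0}"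
    then have "csqrt (- (1 - z)) = \<i> * csqrt (1 - z)" by (intro csqrt_minus) auto
    then show "\<i> * csqrt (1 - z) * csqrt (z + 1) = sqrt_cut z" by (simp add: sqrt_cut_def)
  qed
  ultimately have "(sqrt_cut \<longlongrightarrow> \<i> * of_real (sqrt (1 - x)) * of_real (sqrt (1 + x))) ?F"
    by (rule Lim_transform_eventually)
  then have "(phi b \<longlongrightarrow> (of_real b - of_real x - \<i> * of_real (sqrt (1 - x)) * of_real (sqrt (1 + x))) / of_real b) ?F"
    unfolding phi_def using assms by (intro tendsto_intros) auto
  then have "phi_plus b x = (of_real b - of_real x - \<i> * of_real (sqrt (1 - x)) * of_real (sqrt (1 + x))) / of_real b"
    unfolding phi_plus_def by (intro tendsto_Lim at_within_half_planes_nontrivial)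
  also have "\<i> * complex_of_real (sqrt (1 - x)) * of_real (sqrt (1 + x)) = \<i> * of_real (sqrt (1 - x\<^sup>2))"
    using sqrt_factor[OF assms(1)] by (simp flip: of_real_mult add: mult.assoc)
  also have "(of_real b - of_real x - \<i> * of_real (sqrt (1 - x\<^sup>2))) / of_real b
      = 1 - Complex x (sqrt (1 - x\<^sup>2)) / of_real b"
    using assms by (simp add: Complex_eq field_simps)
  finally show ?thesis .
qed

lemma phi_minus_eq:
  assumes "\<bar>x\<bar> \<le> 1" "b \<noteq> 0"
  shows "phi_minus b x = 1 - Complex x (- sqrt (1 - x\<^sup>2)) / of_real b"
proof -
  let ?F = "at (complex_of_real x) within {z. Im z < 0}"
  have "((\<lambda>z. - \<i> * csqrt (1 - z) * csqrt (z + 1)) \<longlongrightarrow>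
      - \<i> * of_real (sqrt (1 - x)) * of_real (sqrt (1 + x))) ?F"
    using assms by (intro tendsto_intros tendsto_within_subset[OF tendsto_csqrt_one_minus]
        tendsto_within_subset[OF tendsto_csqrt_plus_one]) auto
  moreover have "\<forall>\<^sub>F z in ?F. - \<i> * csqrt (1 - z) * csqrt (z + 1) = sqrt_cut z"
    unfolding eventually_at_filter
  proof (intro always_eventually allI impI)
    fix z :: complex assume "z \<in> {z. Im z < 0}"
    then have "csqrt (- (z - 1)) = \<i> * csqrt (z - 1)" by (intro csqrt_minus) auto
    then have "- \<i> * csqrt (1 - z) = csqrt (z - 1)" by simp
    then show "- \<i> * csqrt (1 - z) * csqrt (z + 1) = sqrt_cut z" unfolding sqrt_cut_def by (rule arg_cong)
  qed
  ultimately have "(sqrt_cut \<longlongrightarrow> - \<i> * of_real (sqrt (1 - x)) * of_real (sqrt (1 + x))) ?F"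
    by (rule Lim_transform_eventually)
  then have "(phi b \<longlongrightarrow> (of_real b - of_real x - (- \<i> * of_real (sqrt (1 - x)) * of_real (sqrt (1 + x)))) / of_real b) ?F"
    unfolding phi_def using assms by (intro tendsto_intros) auto
  then have "phi_minus b x = (of_real b - of_real x - (- \<i> * of_real (sqrt (1 - x)) * of_real (sqrt (1 + x)))) / of_real b"
    unfolding phi_minus_def by (intro tendsto_Lim at_within_half_planes_nontrivial)
  also have "- \<i> * complex_of_real (sqrt (1 - x)) * of_real (sqrt (1 + x)) = - \<i> * of_real (sqrt (1 - x\<^sup>2))"
    using sqrt_factor[OF assms(1)] by (simp flip: of_real_mult add: mult.assoc)
  also have "(of_real b - of_real x - (- \<i> * of_real (sqrt (1 - x\<^sup>2)))) / of_real b
      = 1 - Complex x (- sqrt (1 - x\<^sup>2)) / of_real b"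
    using assms by (simp add: Complex_eq field_simps)
  finally show ?thesis .
qed

lemma norm_phi_plus_eq_1_iff:
  assumes "\<bar>x\<bar> \<le> 1" "b \<noteq> 0"
  shows "norm (phi_plus b x) = 1 \<longleftrightarrow> x = 1 / (2 * b)"
proof -
  have "x\<^sup>2 \<le> 1" using assms(1) by (simp add: abs_square_le_1)
  then have "norm (Complex x (sqrt (1 - x\<^sup>2))) = 1" by (simp add: cmod_def)
  then have "(norm (phi_plus b x))\<^sup>2 * b\<^sup>2 = b\<^sup>2 - 2 * b * x + 1"
    using norm_one_minus_divide_squared[OF assms(2), of "Complex x (sqrt (1 - x\<^sup>2))"]
    unfolding phi_plus_eq[OF assms] by simp
  moreover have "norm (phi_plus b x) = 1 \<longleftrightarrow> (norm (phi_plus b x))\<^sup>2 * b\<^sup>2 = 1 * b\<^sup>2"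
    using assms(2) power2_eq_iff_nonneg[of "norm (phi_plus b x)" 1] by simp
  ultimately show ?thesis using assms(2) by (auto simp: field_simps)
qed

text \<open>The crossing point is the only point of the cut on which the boundary values have modulus one.\<close>

lemma loop_L_minus_crossing:
  assumes "b < - 1 / 2"
  shows "loop_L b - {of_real (1 / (2 * b))} = {z. z \<notin> of_real ` {-1..1} \<and> norm (phi b z) = 1}"
proof -
  have m: "1 / (2 * b) \<in> {-1..1}" using assms by (simp add: field_simps)
  have "x = 1 / (2 * b)" if "x \<in> {-1..1}" "norm (phi_plus b x) = 1" for x
    using norm_phi_plus_eq_1_iff[of x b] that assms by (auto simp: abs_le_iff)
  then have "of_real ` {x \<in> {-1..1}. norm (phi_plus b x) = 1 \<and> norm (phi_minus b x) = 1}
      \<subseteq> {complex_of_real (1 / (2 * b))}" by blast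
  moreover have "complex_of_real (1 / (2 * b)) \<in> of_real ` {-1..1}" using m by (rule imageI)
  ultimately show ?thesis unfolding loop_L_def by blast
qed

text \<open>The cosine of the angle at which the loop closes. It is both the real part of the end points
  \<open>c\<^sub>+\<close>, \<open>c\<^sub>-\<close> of the arc and the value of \<open>U\<close> at the left end of \<open>I\<^sub>b\<close>.\<close>

definition crit :: "real \<Rightarrow> real" where
  "crit b = 1 - 1 / (2 * b\<^sup>2)"

lemma crit_bounds:
  assumes "b < - 1 / 2"
  shows "- 1 < crit b" "crit b < 1"
proof -
  have "b * b > (1 / 2) * (1 / 2)" using assms mult_strict_mono[of "1/2" "- b" "1/2" "- b"] by simp
  then have "b\<^sup>2 > 1 / 4" by (simp add: power2_eq_square)
  then have "b\<^sup>2 > 0" by linarith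
  then have "1 / (2 * b\<^sup>2) < 2" "1 / (2 * b\<^sup>2) > 0" using \<open>b\<^sup>2 > 1 / 4\<close> by (simp_all add: divide_less_eq)
  then show "- 1 < crit b" "crit b < 1" by (simp_all add: crit_def)
qed

lemma unit_eq_cis_arccos:
  assumes "norm z = 1" "Im z \<ge> 0"
  shows "z = cis (arccos (Re z))"
proof -
  have r: "\<bar>Re z\<bar> \<le> 1" using abs_Re_le_cmod[of z] assms by simp
  have "(Re z)\<^sup>2 + (Im z)\<^sup>2 = 1" using assms(1) by (simp flip: cmod_power2)
  then have "Im z = sqrt (1 - (Re z)\<^sup>2)" using assms(2) by (intro real_sqrt_unique[symmetric]) auto
  then show ?thesis using r by (simp add: complex_eq_iff cos_arccos_abs sin_arccos_abs)
qed

lemma phi_crossing: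
  assumes b: "b < - 1 / 2"
  shows "phi_plus b (1 / (2 * b)) = cis (arccos (crit b))"
    "phi_minus b (1 / (2 * b)) = cis (- arccos (crit b))"
proof -
  let ?x = "1 / (2 * b)"
  have b0: "b \<noteq> 0" and x: "\<bar>?x\<bar> \<le> 1" using b by (auto simp: abs_if field_simps)
  have "norm (phi_plus b ?x) = 1" using norm_phi_plus_eq_1_iff[OF x b0] by simp
  moreover have "Re (phi_plus b ?x) = crit b"
    unfolding phi_plus_eq[OF x b0] crit_def by (simp add: power2_eq_square)
  moreover have "Im (phi_plus b ?x) \<ge> 0"
  proof -
    have "?x\<^sup>2 \<le> 1" using x by (simp only: abs_square_le_1)
    then show ?thesis unfolding phi_plus_eq[OF x b0] using b by (simp add: divide_le_0_iff)
  qed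
  ultimately show 1: "phi_plus b ?x = cis (arccos (crit b))" using unit_eq_cis_arccos by metis
  have "phi_minus b ?x = cnj (phi_plus b ?x)"
    unfolding phi_plus_eq[OF x b0] phi_minus_eq[OF x b0] by (simp add: complex_eq_iff)
  then show "phi_minus b ?x = cis (- arccos (crit b))" unfolding 1 by (simp add: cis_cnj)
qed

lemma cos_less_cos_iff:
  assumes "0 \<le> t" "t \<le> 2 * pi" "0 \<le> a" "a \<le> pi"
  shows "cos t < cos a \<longleftrightarrow> a < t \<and> t < 2 * pi - a"
proof (cases "t \<le> pi")
  case True
  then show ?thesis using assms cos_mono_less_eq[of t a] by auto
next
  case False
  have "cos t = cos (2 * pi - t)" by (simp add: cos_diff)
  then show ?thesis using False assms cos_mono_less_eq[of "2 * pi - t" a] by auto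
qed

text \<open>In this form the arc is a Borel set, and membership is a condition on the cosine of the angle
  only.\<close>

lemma ccw_arc_crossing:
  assumes b: "b < - 1 / 2"
  shows "ccw_arc (phi_plus b (1 / (2 * b))) (phi_minus b (1 / (2 * b))) = {p. norm p = 1 \<and> Re p < crit b}"
proof -
  define a where "a = arccos (crit b)"
  have c: "-1 \<le> crit b" "crit b \<le> 1" using crit_bounds[OF b] by auto
  have a: "0 \<le> a" "a \<le> pi" "cos a = crit b" using c by (auto simp: a_def arccos_lbound arccos_ubound)
  have a0: "a > 0"
    using a crit_bounds(2)[OF b] by (cases "a = 0") auto
  have "cis (- a) / cis a = cis (2 * pi - 2 * a)"
    by (simp add: cis_divide complex_eq_iff cos_diff sin_diff)
  moreover have "Arg2pi (cis (2 * pi - 2 * a)) = 2 * pi - 2 * a"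
    using a a0 by (intro Arg2pi_unique[of 1]) (auto simp: cis_conv_exp)
  ultimately have arc: "ccw_arc (phi_plus b (1 / (2 * b))) (phi_minus b (1 / (2 * b)))
      = (\<lambda>t. cis (a + t)) ` {0<..<2 * pi - 2 * a}"
    unfolding ccw_arc_def phi_crossing[OF b] a_def[symmetric] by (simp add: cis_mult)
  have "cis (a + t) \<in> {p. norm p = 1 \<and> Re p < crit b}" if "t \<in> {0<..<2 * pi - 2 * a}" for t
    using cos_less_cos_iff[of "a + t" a] that a by auto
  moreover have "p \<in> (\<lambda>t. cis (a + t)) ` {0<..<2 * pi - 2 * a}" if p: "norm p = 1" "Re p < crit b" for p
  proof
    have "p = cis (Arg2pi p)" using Arg2pi_eq[of p] p(1) by (simp add: cis_conv_exp)
    then show "p = cis (a + (Arg2pi p - a))" by simp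
    have "cos (Arg2pi p) < cos a" using p a(3) \<open>p = cis (Arg2pi p)\<close> by (metis cis.sel(1))
    then show "Arg2pi p - a \<in> {0<..<2 * pi - 2 * a}"
      using cos_less_cos_iff[of "Arg2pi p" a] a Arg2pi_ge_0[of p] Arg2pi_lt_2pi[of p] by auto
  qed
  ultimately show ?thesis unfolding arc by blast
qed

text \<open>On the open arc the second factor is strictly smaller than one in modulus, which makes \<open>u\<^sup>n = 1\<close> the
  leading part of the equation there.\<close>

lemma loop_parameter_bounds:
  assumes b: "b < 0" and p: "norm p = 1" "Re p < crit b"
  shows "norm (of_real b * (1 - p)) > 1" "norm (inner_factor b p) < 1"
proof -
  define \<zeta> where "\<zeta> = of_real b * (1 - p)"
  have b2: "b\<^sup>2 > 0" "b \<noteq> 0" using b by auto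
  have pu: "p = 1 - \<zeta> / of_real b" using b by (simp add: \<zeta>_def)
  have e: "b\<^sup>2 = b\<^sup>2 - 2 * b * Re \<zeta> + (norm \<zeta>)\<^sup>2"
    using norm_one_minus_divide_squared[OF b2(2), of \<zeta>] p(1) unfolding pu[symmetric] by simp
  have "1 < (1 - Re p) * (2 * b\<^sup>2)" using p(2) b2 unfolding crit_def by (simp add: field_simps)
  also have "\<dots> = 2 * b * Re \<zeta>" by (simp add: \<zeta>_def power2_eq_square)
  finally have "1 < 2 * b * Re \<zeta>" .
  then have s: "(norm \<zeta>)\<^sup>2 > 1" using e by simp
  then show "norm (of_real b * (1 - p)) > 1"
    unfolding \<zeta>_def[symmetric] using power_le_one[of "norm \<zeta>" 2] by (cases "norm \<zeta> > 1") auto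
  have \<zeta>0: "\<zeta> \<noteq> 0" using s by auto
  have "(norm (inner_factor b p))\<^sup>2 * (b\<^sup>2 * (norm \<zeta>)\<^sup>2) = b\<^sup>2 * (norm \<zeta>)\<^sup>2 - 2 * b * Re \<zeta> + 1"
    using norm_inner_squared[OF b2(2) \<zeta>0] inner_factor_outer[OF b2(2) \<zeta>0] unfolding pu[symmetric]
    by (simp add: mult.assoc)
  also have "\<dots> < 1 * (b\<^sup>2 * (norm \<zeta>)\<^sup>2)" using \<open>1 < 2 * b * Re \<zeta>\<close> by simp
  finally have "(norm (inner_factor b p))\<^sup>2 < 1"
    using b2 \<zeta>0 by (subst (asm) mult_less_cancel_right) auto
  then show "norm (inner_factor b p) < 1" by (simp add: power2_less_1_iff)
qed

text \<open>Solving \<open>p = 1 - \<zeta> / b\<close> for \<open>\<zeta>\<close> inverts \<open>phi b\<close>. The result is on the loop because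
  \<open>|\<zeta>| > 1\<close> places \<open>J \<zeta>\<close> off the cut.\<close>

lemma the_inv_into_phi_loop:
  assumes b: "b < - 1 / 2" and p: "norm p = 1" "Re p < crit b"
  shows "the_inv_into (loop_L b - {of_real (1 / (2 * b))}) (phi b) p = joukowski (of_real b * (1 - p))"
proof (rule the_inv_into_f_eq)
  have b0: "b \<noteq> 0" "b < 0" using b by auto
  define \<zeta> where "\<zeta> = of_real b * (1 - p)"
  have \<zeta>: "norm \<zeta> > 1" unfolding \<zeta>_def by (rule loop_parameter_bounds[OF b0(2) p])
  then have \<zeta>0: "\<zeta> \<noteq> 0" by auto
  show phi: "phi b (joukowski (of_real b * (1 - p))) = p"
    using phi_eq_outer_root[OF b0(1)] outer_root_joukowski[OF \<zeta>] b0 by (simp add: \<zeta>_def)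
  have "joukowski \<zeta> \<notin> of_real ` {-1..1}"
    using joukowski_mem_interval_imp_unit[OF \<zeta>0] \<zeta> by force
  then show "joukowski (of_real b * (1 - p)) \<in> loop_L b - {of_real (1 / (2 * b))}"
    unfolding loop_L_minus_crossing[OF b] using phi p by (simp add: \<zeta>_def)
  show "inj_on (phi b) (loop_L b - {of_real (1 / (2 * b))})"
  proof (rule inj_onI)
    fix z w assume "phi b z = phi b w"
    then have "outer_root z = outer_root w" using phi_eq_outer_root[OF b0(1)] b0(1) by simp
    then show "z = w" using joukowski_outer_root by metis
  qed
qed

lemma map_U_radicand:
  fixes b x :: real
  assumes b: "b < - 1 / 2" and x: "x \<ge> 1 / (2 * b)"
  shows "b\<^sup>2 + 1 - 2 * b * x \<ge> b\<^sup>2" "b\<^sup>2 > 0"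
  using assms by (auto simp: field_simps)

text \<open>The derivative is \<open>(1 - b x) / (b\<^sup>2 + 1 - 2 b x)\<^bsup>3/2\<^esup>\<close>, and \<open>b x \<le> 1 / 2\<close> on \<open>I\<^sub>b\<close>.\<close>

lemma map_U_strict_mono: 
  assumes b: "b < - 1 / 2"
  shows "strict_mono_on (interval_I b) (map_U b)"
proof (rule strict_mono_onI)
  fix x y assume xy: "x \<in> interval_I b" "y \<in> interval_I b" "x < y"
  show "map_U b x < map_U b y"
  proof (rule DERIV_pos_imp_increasing[OF xy(3)])
    fix t assume "x \<le> t" "t \<le> y"
    then have t: "t \<ge> 1 / (2 * b)" using xy by (auto simp: interval_I_def)
    then have t2: "2 * b * t \<le> 1" using b by (simp add: field_simps)
    define s where "s = b\<^sup>2 + 1 - 2 * b * t"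
    have s: "s > 0" using map_U_radicand[OF b t] unfolding s_def by linarith
    have d1: "((\<lambda>x. b\<^sup>2 + 1 - 2 * b * x) has_real_derivative - (2 * b)) (at t)"
      by (auto intro!: derivative_eq_intros)
    have d2: "((\<lambda>x. sqrt (b\<^sup>2 + 1 - 2 * b * x)) has_real_derivative inverse (sqrt s) / 2 * - (2 * b)) (at t)"
      by (rule DERIV_chain2[OF _ d1]) (use DERIV_real_sqrt[OF s] in \<open>simp add: s_def\<close>)
    have d3: "((\<lambda>x. x - b) has_real_derivative 1) (at t)"
      by (auto intro!: derivative_eq_intros)
    have "(map_U b has_real_derivative (1 * sqrt s - (t - b) * (inverse (sqrt s) / 2 * - (2 * b))) / (sqrt s * sqrt s)) (at t)"
      unfolding map_U_def s_def by (rule DERIV_divide[OF d3 d2[unfolded s_def]]) (use s in \<open>simp add: s_def\<close>)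
    moreover have "(1 * sqrt s - (t - b) * (inverse (sqrt s) / 2 * - (2 * b))) / (sqrt s * sqrt s) = (1 - b * t) / (s * sqrt s)"
    proof -
      have "1 * sqrt s - (t - b) * (inverse (sqrt s) / 2 * - (2 * b)) = (s + (t - b) * b) / sqrt s"
        using s by (simp add: field_simps)
      also have "s + (t - b) * b = 1 - b * t" by (simp add: s_def power2_eq_square algebra_simps)
      finally show ?thesis using s by simp
    qed
    moreover have "(1 - b * t) / (s * sqrt s) > 0" using t2 s by (intro divide_pos_pos mult_pos_pos) auto
    ultimately show "\<exists>y. (map_U b has_real_derivative y) (at t) \<and> 0 < y" by auto
  qed
qed

lemma continuous_on_map_U:
  assumes b: "b < - 1 / 2"
  shows "continuous_on (interval_I b) (map_U b)"
proof -
  have "b\<^sup>2 + 1 - 2 * b * x \<noteq> 0" if "x \<in> interval_I b" for x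
    using map_U_radicand[OF b, of x] that unfolding interval_I_def atLeastAtMost_iff by linarith
  then show ?thesis unfolding map_U_def by (intro continuous_intros) auto
qed

lemma map_U_endpoints:
  assumes b: "b < - 1 / 2"
  shows "map_U b (1 / (2 * b)) = crit b" "map_U b 1 = 1"
proof -
  have "sqrt (b\<^sup>2 + 1 - 2 * b * (1 / (2 * b))) = - b" using b by simp
  then show "map_U b (1 / (2 * b)) = crit b"
    using b unfolding map_U_def crit_def by (simp add: field_simps power2_eq_square)
  have "b\<^sup>2 + 1 - 2 * b * 1 = (1 - b)\<^sup>2" by (simp add: power2_eq_square algebra_simps)
  then show "map_U b 1 = 1" using b unfolding map_U_def by simp
qed

lemma map_U_image:
  assumes b: "b < - 1 / 2"
  shows "map_U b ` interval_I b = {crit b..1}"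
proof
  have le: "1 / (2 * b) \<le> 1" using b by (simp add: field_simps)
  have mono: "map_U b x \<le> map_U b y" if "x \<in> interval_I b" "y \<in> interval_I b" "x \<le> y" for x y
    using strict_mono_on_leD[OF map_U_strict_mono[OF b]] that by blast
  show "map_U b ` interval_I b \<subseteq> {crit b..1}"
  proof (rule image_subsetI)
    fix x assume x: "x \<in> interval_I b"
    then show "map_U b x \<in> {crit b..1}"
      using mono[of "1 / (2 * b)" x] mono[of x 1] le unfolding map_U_endpoints[OF b]
      by (auto simp: interval_I_def)
  qed
  show "{crit b..1} \<subseteq> map_U b ` interval_I b"
  proof
    fix y assume "y \<in> {crit b..1}"
    then have "\<exists>x. 1 / (2 * b) \<le> x \<and> x \<le> 1 \<and> map_U b x = y"
      using IVT'[of "map_U b" "1 / (2 * b)" y 1] map_U_endpoints[OF b] le continuous_on_map_U[OF b]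
      by (auto simp: interval_I_def)
    then show "y \<in> map_U b ` interval_I b" by (auto simp: interval_I_def)
  qed
qed

definition inv_U :: "real \<Rightarrow> real \<Rightarrow> real" where
  "inv_U b = the_inv_into (interval_I b) (map_U b)"

lemma map_U_inv_U:
  assumes b: "b < - 1 / 2" and y: "y \<in> {crit b..1}"
  shows "inv_U b y \<in> interval_I b" "map_U b (inv_U b y) = y"
proof -
  have inj: "inj_on (map_U b) (interval_I b)"
    by (rule strict_mono_on_imp_inj_on[OF map_U_strict_mono[OF b]])
  show "inv_U b y \<in> interval_I b" "map_U b (inv_U b y) = y"
    using the_inv_into_into[OF inj, of y] f_the_inv_into_f[OF inj, of y] y map_U_image[OF b]
    by (auto simp: inv_U_def)
qed

lemma continuous_on_inv_U:
  assumes b: "b < - 1 / 2"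
  shows "continuous_on {crit b..1} (inv_U b)"
proof -
  have inj: "inj_on (map_U b) (interval_I b)"
    by (rule strict_mono_on_imp_inj_on[OF map_U_strict_mono[OF b]])
  have "continuous_on (map_U b ` interval_I b) (inv_U b)"
    by (rule continuous_on_inv[OF continuous_on_map_U[OF b]])
       (auto simp: interval_I_def inv_U_def the_inv_into_f_f[OF inj, unfolded interval_I_def])
  then show ?thesis unfolding map_U_image[OF b] .
qed

section \<open>The limit measure as the law of a curve at a uniform angle\<close>

definition uniform_angle :: "real measure" where
  "uniform_angle = uniform_measure lborel {0..<2 * pi}"

lemma sets_uniform_angle [measurable_cong, simp]: "sets uniform_angle = sets borel"
  by (simp add: uniform_angle_def)

lemma space_uniform_angle [simp]: "space uniform_angle = UNIV"
  by (simp add: uniform_angle_def)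

lemma prob_space_uniform_angle: "prob_space uniform_angle"
  unfolding uniform_angle_def by (rule prob_space_uniform_measure) auto

lemma emeasure_uniform_angle:
  "A \<in> sets borel \<Longrightarrow> emeasure uniform_angle A = emeasure lborel ({0..<2 * pi} \<inter> A) / ennreal (2 * pi)"
  by (simp add: uniform_angle_def)

text \<open>The substitution \<open>x = cos t\<close> is increasing on \<open>[\<pi>, 2 \<pi>]\<close> and cancels the density except at the two
  end points.\<close>

lemma emeasure_arcsine:
  assumes A [measurable]: "A \<in> sets borel"
  shows "emeasure arcsine_measure A = emeasure lborel ({pi..2 * pi} \<inter> cos -` A) / ennreal pi"
proof -
  define f where "f x = indicator A x / (pi * sqrt (1 - x\<^sup>2))" for x :: real
  have [measurable]: "f \<in> borel_measurable borel" unfolding f_def by measurable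
  have "emeasure arcsine_measure A
      = (\<integral>\<^sup>+x. ennreal (indicator {-1..1} x / (pi * sqrt (1 - x\<^sup>2))) * indicator A x \<partial>lborel)"
    unfolding arcsine_measure_def by (subst emeasure_density) auto
  also have "\<dots> = (\<integral>\<^sup>+x. ennreal (f x * indicator {cos pi..cos (2 * pi)} x) \<partial>lborel)"
    by (intro nn_integral_cong) (auto simp: f_def split: split_indicator)
  also have "\<dots> = (\<integral>\<^sup>+t. ennreal (f (cos t) * (- sin t) * indicator {pi..2 * pi} t) \<partial>lborel)"
  proof (rule nn_integral_substitution)
    show "set_borel_measurable borel {cos pi..cos (2 * pi)} f"
      unfolding set_borel_measurable_def by measurable
    show "(cos has_real_derivative - sin t) (at t)" for t by (auto intro!: derivative_eq_intros)
    show "continuous_on {pi..2 * pi} (\<lambda>t. - sin t)" by (intro continuous_intros)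
    show "- sin t \<ge> 0" if "t \<in> {pi..2 * pi}" for t
      using that sin_ge_zero[of "t - pi"] by (simp add: sin_diff)
  qed auto
  also have "\<dots> = (\<integral>\<^sup>+t. ennreal (1 / pi) * indicator ({pi..2 * pi} \<inter> cos -` A) t \<partial>lborel)"
  proof (rule nn_integral_cong_AE)
    have "AE t in lborel. t \<noteq> pi" "AE t in lborel. t \<noteq> 2 * pi" by (simp_all add: AE_lborel_singleton)
    then show "AE t in lborel. ennreal (f (cos t) * (- sin t) * indicator {pi..2 * pi} t)
        = ennreal (1 / pi) * indicator ({pi..2 * pi} \<inter> cos -` A) t"
    proof eventually_elim
      case (elim t)
      show ?case
      proof (cases "t \<in> {pi..2 * pi}")
        case True
        then have s: "- sin t > 0" using elim sin_gt_zero[of "t - pi"] by (simp add: sin_diff)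
        have "sqrt (1 - (cos t)\<^sup>2) = - sin t"
          using s by (simp flip: sin_squared_eq)
        then have "f (cos t) * (- sin t) = indicator A (cos t) / pi"
          using s by (simp add: f_def field_simps)
        then show ?thesis using True by (simp split: split_indicator)
      qed auto
    qed
  qed
  also have "\<dots> = ennreal (1 / pi) * emeasure lborel ({pi..2 * pi} \<inter> cos -` A)"
  proof -
    have "cos -` A \<in> sets borel" using measurable_sets[of cos borel borel A] by simp
    then show ?thesis by (subst nn_integral_cmult_indicator) auto
  qed
  also have "\<dots> = emeasure lborel ({pi..2 * pi} \<inter> cos -` A) / ennreal pi"
    using inverse_ennreal[of pi] by (simp add: divide_ennreal_def mult.commute inverse_eq_divide)
  finally show ?thesis .
qed

lemma emeasure_lborel_reflect:
  fixes c :: real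
  assumes [measurable]: "S \<in> sets borel"
  shows "emeasure lborel ((\<lambda>t. c - t) -` S) = emeasure lborel S"
proof -
  have "emeasure lborel S = (\<integral>\<^sup>+x. indicator S x \<partial>lborel)" by simp
  also have "\<dots> = ennreal \<bar>-1\<bar> * (\<integral>\<^sup>+x. indicator S (c + (-1) * x) \<partial>lborel)"
    by (rule nn_integral_real_affine) auto
  also have "\<dots> = (\<integral>\<^sup>+x. indicator ((\<lambda>t. c - t) -` S) x \<partial>lborel)"
    by (simp add: indicator_def)
  also have "\<dots> = emeasure lborel ((\<lambda>t. c - t) -` S)"
  proof (rule nn_integral_indicator)
    have "(\<lambda>t. c - t) \<in> borel_measurable borel" by measurable
    from measurable_sets[OF this assms] show "(\<lambda>t. c - t) -` S \<in> sets lborel" by simp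
  qed
  finally show ?thesis ..
qed

lemma emeasure_lborel_drop_point:
  assumes "S \<in> sets borel" "T \<in> sets borel" "S - {c} = T - {c}"
  shows "emeasure lborel S = emeasure lborel (T :: real set)"
proof (rule emeasure_eq_AE)
  show "AE x in lborel. x \<in> S \<longleftrightarrow> x \<in> T"
    using AE_lborel_singleton[of c] by eventually_elim (use assms(3) in blast)
qed (use assms in auto)

text \<open>Reflection at \<open>\<pi>\<close> maps the two halves of the circle to each other and preserves the cosine.\<close>

lemma arcsine_measure_eq: "arcsine_measure = distr uniform_angle borel cos"
proof (rule measure_eqI)
  show "sets arcsine_measure = sets (distr uniform_angle borel cos)" by (simp add: arcsine_measure_def)
  fix A assume "A \<in> sets arcsine_measure"
  then have A: "A \<in> sets borel" by (simp add: arcsine_measure_def)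
  have [measurable]: "cos -` A \<in> sets borel" using measurable_sets[of cos borel borel A] A by simp
  define m where "m = emeasure lborel ({pi..2 * pi} \<inter> cos -` A)"
  have "emeasure lborel ({0..<2 * pi} \<inter> cos -` A)
      = emeasure lborel ({0..<pi} \<inter> cos -` A) + emeasure lborel ({pi..<2 * pi} \<inter> cos -` A)"
    by (subst plus_emeasure) (auto intro!: arg_cong[of _ _ "emeasure lborel"])
  moreover have "emeasure lborel ({pi..<2 * pi} \<inter> cos -` A) = m"
    unfolding m_def by (rule emeasure_lborel_drop_point[of _ _ "2 * pi"]) auto
  moreover have "emeasure lborel ({0..<pi} \<inter> cos -` A) = m"
  proof -
    have "{0..<pi} \<inter> cos -` A = (\<lambda>t. 2 * pi - t) -` ({pi<..2 * pi} \<inter> cos -` A)"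
      by (auto simp: cos_diff)
    then have "emeasure lborel ({0..<pi} \<inter> cos -` A) = emeasure lborel ({pi<..2 * pi} \<inter> cos -` A)"
      by (simp only:) (rule emeasure_lborel_reflect, measurable)
    also have "\<dots> = m" unfolding m_def by (rule emeasure_lborel_drop_point[of _ _ pi]) auto
    finally show ?thesis .
  qed
  ultimately have "emeasure uniform_angle (cos -` A) = (m + m) / ennreal (2 * pi)"
    by (simp add: emeasure_uniform_angle)
  also have "\<dots> = m / ennreal pi"
  proof -
    have "ennreal (2 * pi) = 2 * ennreal pi" by (simp add: ennreal_mult)
    then have "(m + m) / ennreal (2 * pi) = (2 * m) / (2 * ennreal pi)" by (simp only: mult_2)
    also have "\<dots> = m / ennreal pi" using divide_mult_eq[of 2 m "ennreal pi"] by (simp add: mult.commute)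
    finally show ?thesis .
  qed
  finally show "emeasure arcsine_measure A = emeasure (distr uniform_angle borel cos) A"
    using A emeasure_arcsine[OF A] by (simp add: emeasure_distr m_def)
qed

lemma circle_measure_eq: "circle_measure = distr uniform_angle borel cis"
  by (simp add: circle_measure_def uniform_angle_def)

text \<open>An angle \<open>t\<close> with large cosine is sent to the interval, the others to the point of the loop whose
  image under \<open>phi b\<close> is \<open>cis t\<close>. Each interior point of the interval is reached from two angles, which
  is why the arcsine law of \<open>[-1, 1]\<close> comes from the full circle.\<close>

definition limit_curve :: "real \<Rightarrow> real \<Rightarrow> complex" where
  "limit_curve b t = (if crit b \<le> cos t then of_real (inv_U b (cos t))
                      else joukowski (of_real b * (1 - cis t)))"

lemma vimage_cis_measurable: "B \<in> sets borel \<Longrightarrow> cis -` B \<in> sets borel"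
  using measurable_sets[of cis borel borel B] borel_measurable_continuous_onI[of cis] continuous_on_cis[of UNIV "\<lambda>t. t"]
  by simp

lemma vimage_cos_measurable: "B \<in> sets borel \<Longrightarrow> (cos :: real \<Rightarrow> real) -` B \<in> sets borel"
  using measurable_sets[of cos borel borel B] by simp

lemma interval_part_vimage:
  assumes b: "b < - 1 / 2" and A: "A \<in> sets borel"
  defines "S \<equiv> {y \<in> {crit b..1}. complex_of_real (inv_U b y) \<in> A}"
  shows "S \<in> sets borel" "emeasure (interval_part b) A = emeasure uniform_angle (cos -` S)"
proof -
  have f: "(\<lambda>y. complex_of_real (inv_U b y)) \<in> borel_measurable (restrict_space borel {crit b..1})"
    by (intro borel_measurable_continuous_on_restrict continuous_on_of_real continuous_on_inv_U[OF b])
  have vi: "(\<lambda>y. complex_of_real (inv_U b y)) -` A \<inter> {crit b..1} = S" by (auto simp: S_def)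
  have "S \<in> sets (restrict_space borel {crit b..1})"
    using measurable_sets[OF f A] vi by (simp add: space_restrict_space)
  then show S: "S \<in> sets borel" by (subst (asm) sets_restrict_space_iff) auto
  have m: "sets arcsine_measure = sets borel" "space arcsine_measure = UNIV"
    by (simp_all add: arcsine_measure_def)
  have f': "(\<lambda>y. complex_of_real (inv_U b y)) \<in> borel_measurable (restrict_space arcsine_measure {crit b..1})"
    using f by (simp cong: measurable_cong_sets add: sets_restrict_space_cong[OF m(1)])
  have "emeasure (interval_part b) A = emeasure (restrict_space arcsine_measure {crit b..1}) S"
    unfolding interval_part_def map_U_image[OF b] inv_U_def[symmetric]
    using emeasure_distr[OF f' A] vi by (simp add: space_restrict_space m)
  also have "\<dots> = emeasure arcsine_measure S"
    by (rule emeasure_restrict_space) (auto simp: m S_def)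
  also have "\<dots> = emeasure uniform_angle (cos -` S)"
    unfolding arcsine_measure_eq by (subst emeasure_distr) (use S in auto)
  finally show "emeasure (interval_part b) A = emeasure uniform_angle (cos -` S)" .
qed

lemma loop_part_vimage:
  assumes b: "b < - 1 / 2" and A: "A \<in> sets borel"
  defines "S \<equiv> {p. norm p = 1 \<and> Re p < crit b \<and> joukowski (of_real b * (1 - p)) \<in> A}"
  shows "S \<in> sets borel" "emeasure (loop_part b) A = emeasure uniform_angle (cis -` S)"
proof -
  let ?arc = "{p :: complex. norm p = 1 \<and> Re p < crit b}"
  let ?g = "the_inv_into (loop_L b - {of_real (1 / (2 * b))}) (phi b)"
  have arc: "?arc \<in> sets borel"
  proof -
    have "closed {p :: complex. norm p = 1}" using closed_sphere[of "0 :: complex" 1] by (simp add: sphere_def dist_norm)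
    moreover have "open {p :: complex. Re p < crit b}" by (rule open_halfspace_Re_lt)
    ultimately have "{p :: complex. norm p = 1} \<inter> {p. Re p < crit b} \<in> sets borel" by auto
    then show ?thesis by (simp add: Int_def)
  qed
  have g: "?g p = joukowski (of_real b * (1 - p))" if "p \<in> ?arc" for p
    using the_inv_into_phi_loop[OF b] that by blast
  have "of_real b * (1 - p) \<noteq> 0" if "p \<in> ?arc" for p
    using loop_parameter_bounds(1)[of b p] that b by fastforce
  then have "continuous_on ?arc (\<lambda>p. joukowski (of_real b * (1 - p)))"
    unfolding joukowski_def by (intro continuous_intros) auto
  then have "continuous_on ?arc ?g" by (rule continuous_on_eq) (use g in simp)
  then have f: "?g \<in> borel_measurable (restrict_space borel ?arc)"
    by (rule borel_measurable_continuous_on_restrict)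
  have vi: "?g -` A \<inter> ?arc = S" using g by (auto simp: S_def)
  have "S \<in> sets (restrict_space borel ?arc)"
    using measurable_sets[OF f A] vi by (simp add: space_restrict_space)
  then show S: "S \<in> sets borel" using arc by (subst (asm) sets_restrict_space_iff) auto
  have m: "sets circle_measure = sets borel" "space circle_measure = UNIV"
    by (simp_all add: circle_measure_def)
  have f': "?g \<in> borel_measurable (restrict_space circle_measure ?arc)"
    using f by (simp cong: measurable_cong_sets add: sets_restrict_space_cong[OF m(1)])
  have "emeasure (loop_part b) A = emeasure (restrict_space circle_measure ?arc) S"
    unfolding loop_part_def ccw_arc_crossing[OF b]
    using emeasure_distr[OF f' A] vi by (simp add: space_restrict_space m)
  also have "\<dots> = emeasure circle_measure S"
    by (rule emeasure_restrict_space) (use arc in \<open>auto simp: m S_def\<close>)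
  also have "\<dots> = emeasure uniform_angle (cis -` S)"
    unfolding circle_measure_eq
    by (subst emeasure_distr) (use S in \<open>auto intro!: borel_measurable_continuous_onI continuous_intros
        simp: measurable_cong_sets[OF sets_uniform_angle refl]\<close>)
  finally show "emeasure (loop_part b) A = emeasure uniform_angle (cis -` S)" .
qed

text \<open>The two parts of the measure live on complementary sets of angles, separated by the condition
  \<open>crit b \<le> cos t\<close>.\<close>

proposition limit_measure_eq_distr:
  assumes b: "b < - 1 / 2"
  shows "limit_curve b \<in> borel_measurable borel"
    and "add_measure (interval_part b) (loop_part b) = distr uniform_angle borel (limit_curve b)"
proof -
  define S1 where "S1 A = {y \<in> {crit b..1}. complex_of_real (inv_U b y) \<in> A}" for A
  define S2 where "S2 A = {p. norm p = 1 \<and> Re p < crit b \<and> joukowski (of_real b * (1 - p)) \<in> A}" for A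
  have vi: "limit_curve b -` A = cos -` S1 A \<union> cis -` S2 A" for A
    by (auto simp: limit_curve_def S1_def S2_def not_le split: if_splits)
  have dj: "cos -` S1 A \<inter> cis -` S2 A = {}" for A by (auto simp: S1_def S2_def)
  have ms: "cos -` S1 A \<in> sets borel" "cis -` S2 A \<in> sets borel" if "A \<in> sets borel" for A
    unfolding S1_def S2_def
    by (rule vimage_cos_measurable[OF interval_part_vimage(1)[OF b that]]
             vimage_cis_measurable[OF loop_part_vimage(1)[OF b that]])+
  show mb: "limit_curve b \<in> borel_measurable borel"
    by (rule measurableI) (use ms in \<open>auto simp: vi\<close>)
  have sets_add: "sets (add_measure (interval_part b) (loop_part b)) = sets borel"
  proof -
    have "sets (add_measure (interval_part b) (loop_part b)) = sets (interval_part b)"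
      by (simp add: add_measure_def)
    then show ?thesis by (simp add: interval_part_def)
  qed
  show "add_measure (interval_part b) (loop_part b) = distr uniform_angle borel (limit_curve b)"
  proof (rule measure_eqI)
    show "sets (add_measure (interval_part b) (loop_part b)) = sets (distr uniform_angle borel (limit_curve b))"
      by (simp add: sets_add)
    fix A assume "A \<in> sets (add_measure (interval_part b) (loop_part b))"
    then have A: "A \<in> sets borel" by (simp add: sets_add)
    have "emeasure (add_measure (interval_part b) (loop_part b)) A
        = emeasure (interval_part b) A + emeasure (loop_part b) A"
      by (rule emeasure_add_measure) (use A in \<open>simp_all add: interval_part_def loop_part_def\<close>)
    also have "\<dots> = emeasure uniform_angle (cos -` S1 A) + emeasure uniform_angle (cis -` S2 A)"
      unfolding S1_def S2_def interval_part_vimage(2)[OF b A] loop_part_vimage(2)[OF b A] ..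
    also have "\<dots> = emeasure uniform_angle (limit_curve b -` A)"
      unfolding vi by (rule plus_emeasure) (use ms[OF A] dj in auto)
    also have "\<dots> = emeasure (distr uniform_angle borel (limit_curve b)) A"
      by (subst emeasure_distr) (use A mb in \<open>auto simp: measurable_cong_sets[OF sets_uniform_angle refl]\<close>)
    finally show "emeasure (add_measure (interval_part b) (loop_part b)) A
        = emeasure (distr uniform_angle borel (limit_curve b)) A" .
  qed
qed

section \<open>Exhibiting one zero for each cell of angles\<close>

definition grid_angle :: "nat \<Rightarrow> nat \<Rightarrow> real" where
  "grid_angle n j = 2 * pi * real j / real n"

definition cell_index :: "nat \<Rightarrow> real \<Rightarrow> nat" where
  "cell_index n t = nat \<lfloor>real n * t / (2 * pi)\<rfloor>"

lemma cell_index_iff: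
  assumes "n > 0" "t \<ge> 0"
  shows "cell_index n t = j \<longleftrightarrow> grid_angle n j \<le> t \<and> t < grid_angle n (Suc j)"
proof -
  have "cell_index n t = j \<longleftrightarrow> \<lfloor>real n * t / (2 * pi)\<rfloor> = int j"
    using assms by (auto simp: cell_index_def)
  also have "\<dots> \<longleftrightarrow> real j \<le> real n * t / (2 * pi) \<and> real n * t / (2 * pi) < real j + 1"
    by (simp add: floor_eq_iff)
  also have "\<dots> \<longleftrightarrow> grid_angle n j \<le> t \<and> t < grid_angle n (Suc j)"
    using assms by (simp add: grid_angle_def field_simps)
  finally show ?thesis .
qed

lemma grid_angle_Suc: "grid_angle n (Suc j) = grid_angle n j + 2 * pi / real n"
  by (simp add: grid_angle_def add_divide_distrib algebra_simps)

lemma cell_index_bounds: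
  assumes "n > 0" "t \<ge> 0"
  shows "grid_angle n (cell_index n t) \<le> t" "t < grid_angle n (cell_index n t) + 2 * pi / real n"
  using cell_index_iff[OF assms, of "cell_index n t"] by (simp_all add: grid_angle_Suc)

lemma grid_angle_bounds:
  assumes "j < n"
  shows "0 \<le> grid_angle n j" "grid_angle n j + 2 * pi / real n \<le> 2 * pi"
proof -
  show "0 \<le> grid_angle n j" by (simp add: grid_angle_def)
  have "real (Suc j) \<le> real n" using assms by simp
  then have "2 * pi * real (Suc j) \<le> 2 * pi * real n" by (intro mult_left_mono) auto
  then have "2 * pi * real (Suc j) / real n \<le> 2 * pi"
    using assms by (subst pos_divide_le_eq) simp_all
  then show "grid_angle n j + 2 * pi / real n \<le> 2 * pi"
    unfolding grid_angle_Suc[symmetric] by (simp add: grid_angle_def)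
qed

lemma cell_index_less:
  assumes "n > 0" "0 \<le> t" "t < 2 * pi"
  shows "cell_index n t < n"
proof (rule ccontr)
  assume "\<not> cell_index n t < n"
  then have "real n \<le> real (cell_index n t)" by simp
  then have "2 * pi \<le> grid_angle n (cell_index n t)" using assms by (simp add: grid_angle_def field_simps)
  then show False using cell_index_bounds(1)[OF assms(1,2)] assms(3) by simp
qed

lemma cos_sin_n_grid_angle:
  assumes "n > 0"
  shows "cos (real n * grid_angle n j) = 1" "cos (real n * (grid_angle n j + pi / real n)) = - 1"
    "sin (real n * x) = sin (real n * (x - grid_angle n j))"
    "cis (grid_angle n j) ^ n = 1"
proof -
  have g: "real n * grid_angle n j = 2 * pi * real j" using assms by (simp add: grid_angle_def)
  have c: "cos (2 * pi * real j) = 1" "sin (2 * pi * real j) = 0"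
    using cos_int_2pin[of "int j"] sin_int_2pin[of "int j"] by simp_all
  show "cos (real n * grid_angle n j) = 1" by (simp add: g c)
  have "real n * (grid_angle n j + pi / real n) = 2 * pi * real j + pi"
    using assms g by (simp add: algebra_simps)
  then show "cos (real n * (grid_angle n j + pi / real n)) = - 1" by (simp add: c cos_add)
  show "sin (real n * x) = sin (real n * (x - grid_angle n j))"
    by (simp add: right_diff_distrib g sin_diff c)
  show "cis (grid_angle n j) ^ n = 1" 
  proof -
    have "cis (2 * pi * real j) = 1" by (rule complex_eqI) (simp_all only: cis.sel c one_complex.sel)
    then show ?thesis by (simp add: Complex.DeMoivre g)
  qed
qed

lemma grid_angle_inj:
  assumes "n > 0" "\<bar>grid_angle n j - grid_angle n k\<bar> < 2 * pi / real n"
  shows "j = k"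
proof -
  have "grid_angle n j - grid_angle n k = (real j - real k) * (2 * pi / real n)"
    by (simp add: grid_angle_def algebra_simps diff_divide_distrib)
  then have "\<bar>real j - real k\<bar> * (2 * pi / real n) < 1 * (2 * pi / real n)"
    using assms by (simp add: abs_mult)
  then have "\<bar>real j - real k\<bar> < 1" using assms(1) by (subst (asm) mult_less_cancel_right) auto
  then show ?thesis by linarith
qed

lemma cis_grid_angle_inj:
  assumes "j < n" "k < n" "cis (grid_angle n j) = cis (grid_angle n k)"
  shows "j = k"
proof -
  have arg: "Arg2pi (cis (grid_angle n i)) = grid_angle n i" if "i < n" for i
  proof (rule Arg2pi_unique[of 1])
    have "2 * pi / real n > 0" using that by simp
    then show "grid_angle n i < 2 * pi" using grid_angle_bounds(2)[OF that] by linarith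
  qed (use grid_angle_bounds(1)[OF that] in \<open>simp_all add: cis_conv_exp\<close>)
  have "grid_angle n j = grid_angle n k" using arg[OF assms(1)] arg[OF assms(2)] assms(3) by metis
  then show ?thesis using grid_angle_inj[of n j k] assms(1) by simp
qed

text \<open>Only the first half of the cell is allowed. An angle in the reflected cell \<open>n - 1 - j\<close> that gives the
  same point of the interval would be the mirror image of \<open>\<alpha>\<close>, which lies in the second half
  of that cell; so distinct cells yield distinct zeros.\<close>

definition interval_zero :: "real \<Rightarrow> complex poly \<Rightarrow> nat \<Rightarrow> nat \<Rightarrow> complex \<Rightarrow> bool" where
  "interval_zero b p n j z \<longleftrightarrow> poly p z = 0 \<and> crit b \<le> cos (grid_angle n j) \<and>
     (\<exists>\<alpha>. grid_angle n j < \<alpha> \<and> \<alpha> < grid_angle n j + pi / real n \<and> crit b \<le> cos \<alpha> \<and>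
          z = of_real (inv_U b (cos \<alpha>)))"

text \<open>The equation for \<open>u\<close> selects one branch of the \<open>n\<close>-th root of \<open>1 - v\<^sup>n\<close>. The root of unity of the cell
  can be recovered from \<open>u\<close>, so distinct cells yield distinct zeros.\<close>

definition loop_zero :: "real \<Rightarrow> complex poly \<Rightarrow> nat \<Rightarrow> nat \<Rightarrow> complex \<Rightarrow> bool" where
  "loop_zero b p n j z \<longleftrightarrow> poly p z = 0 \<and> cos (grid_angle n j) < crit b \<and>
     (\<exists>u. 1 < norm (of_real b * (1 - u)) \<and> norm (inner_factor b u ^ n) < 1 / 2 \<and>
          u = cis (grid_angle n j) * exp (Ln (1 - inner_factor b u ^ n) / of_nat n) \<and>
          z = joukowski (of_real b * (1 - u)))"

definition cell_zero :: "real \<Rightarrow> complex poly \<Rightarrow> nat \<Rightarrow> nat \<Rightarrow> complex \<Rightarrow> bool" where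
  "cell_zero b p n j z \<longleftrightarrow> interval_zero b p n j z \<or> loop_zero b p n j z"

text \<open>Both angles satisfy \<open>sin (n \<alpha>) > 0\<close>. This excludes \<open>\<alpha> = 2 \<pi> - \<beta>\<close>, and otherwise the angles agree.\<close>

lemma interval_zero_inj:
  assumes b: "b < - 1 / 2" and n: "j < n" "k < n"
    and z: "interval_zero b p n j z" "interval_zero b p n k z"
  shows "j = k"
proof -
  have n0: "n > 0" using n by simp
  obtain \<alpha> where \<alpha>: "grid_angle n j < \<alpha>" "\<alpha> < grid_angle n j + pi / real n" "crit b \<le> cos \<alpha>"
    "z = of_real (inv_U b (cos \<alpha>))" using z(1) unfolding interval_zero_def by blast
  obtain \<beta> where \<beta>: "grid_angle n k < \<beta>" "\<beta> < grid_angle n k + pi / real n" "crit b \<le> cos \<beta>"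
    "z = of_real (inv_U b (cos \<beta>))" using z(2) unfolding interval_zero_def by blast
  have "inv_U b (cos \<alpha>) = inv_U b (cos \<beta>)" using \<alpha>(4) \<beta>(4) by (metis of_real_eq_iff)
  then have eq: "cos \<alpha> = cos \<beta>" 
  proof -
    have "map_U b (inv_U b (cos \<alpha>)) = cos \<alpha>" "map_U b (inv_U b (cos \<beta>)) = cos \<beta>"
      by (rule map_U_inv_U(2)[OF b]; use \<alpha>(3) \<beta>(3) in simp)+
    then show ?thesis using \<open>inv_U b (cos \<alpha>) = inv_U b (cos \<beta>)\<close> by metis
  qed
  have pos: "sin (real n * x) > 0" if "grid_angle n i < x" "x < grid_angle n i + pi / real n" for x i
  proof -
    have "real n * (x - grid_angle n i) > 0" "real n * (x - grid_angle n i) < pi"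
      using that n0 by (simp_all add: field_simps)
    then show ?thesis unfolding cos_sin_n_grid_angle(3)[OF n0, of x i] by (rule sin_gt_zero)
  qed
  have hp: "pi / real n < 2 * pi / real n" using n0 by (simp add: divide_strict_right_mono)
  have r: "0 < \<alpha>" "\<alpha> < 2 * pi" "0 < \<beta>" "\<beta> < 2 * pi"
    using \<alpha> \<beta> hp grid_angle_bounds[OF n(1)] grid_angle_bounds[OF n(2)] by linarith+
  have "\<alpha> = \<beta> \<or> \<alpha> = 2 * pi - \<beta>"
  proof -
    have c: "cos (2 * pi - x) = cos x" for x by (simp add: cos_diff)
    have inj: "x = y" if "0 \<le> x" "x \<le> pi" "0 \<le> y" "y \<le> pi" "cos x = cos y" for x y
      using cos_inj_pi that by blast
    \<comment> \<open>the cosine is injective on \<open>[0, \<pi>]\<close>, so each angle is first reflected into that range\<close>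
    consider "\<alpha> \<le> pi" "\<beta> \<le> pi" | "\<alpha> \<le> pi" "pi < \<beta>" | "pi < \<alpha>" "\<beta> \<le> pi" | "pi < \<alpha>" "pi < \<beta>"
      by linarith
    then show ?thesis
    proof cases
      case 1
      then show ?thesis using inj[of \<alpha> \<beta>] r eq by simp
    next
      case 2
      then show ?thesis using inj[of \<alpha> "2 * pi - \<beta>"] r eq c by simp
    next
      case 3
      then show ?thesis using inj[of "2 * pi - \<alpha>" \<beta>] r eq c by simp
    next
      case 4
      then show ?thesis using inj[of "2 * pi - \<alpha>" "2 * pi - \<beta>"] r eq c by simp
    qed
  qed
  then show ?thesis
  proof
    assume "\<alpha> = \<beta>"
    then have "\<bar>grid_angle n j - grid_angle n k\<bar> < 2 * pi / real n"
      using \<alpha>(1,2) \<beta>(1,2) hp by linarith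
    then show ?thesis by (rule grid_angle_inj[OF n0])
  next
    assume "\<alpha> = 2 * pi - \<beta>"
    then have n\<alpha>: "real n * \<alpha> = 2 * pi * real n - real n * \<beta>" by (simp only: right_diff_distrib mult_ac)
    have c: "cos (2 * pi * real n) = 1" "sin (2 * pi * real n) = 0"
      using cos_int_2pin[of "int n"] sin_int_2pin[of "int n"] by simp_all
    have "sin (real n * \<alpha>) = - sin (real n * \<beta>)" unfolding n\<alpha> sin_diff c by simp
    then show ?thesis using pos[OF \<alpha>(1,2)] pos[OF \<beta>(1,2)] by simp
  qed
qed

lemma loop_zero_inj:
  assumes b: "b < - 1 / 2" and n: "j < n" "k < n"
    and z: "loop_zero b p n j z" "loop_zero b p n k z"
  shows "j = k"
proof -
  obtain u where u: "1 < norm (of_real b * (1 - u))"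
    "u = cis (grid_angle n j) * exp (Ln (1 - inner_factor b u ^ n) / of_nat n)"
    "z = joukowski (of_real b * (1 - u))" using z(1) unfolding loop_zero_def by blast
  obtain w where w: "1 < norm (of_real b * (1 - w))"
    "w = cis (grid_angle n k) * exp (Ln (1 - inner_factor b w ^ n) / of_nat n)"
    "z = joukowski (of_real b * (1 - w))" using z(2) unfolding loop_zero_def by blast
  have "of_real b * (1 - u) = of_real b * (1 - w)"
    using outer_root_joukowski[OF u(1)] outer_root_joukowski[OF w(1)] u(3) w(3) by metis
  then have "u = w" using b by simp
  define E where "E = exp (Ln (1 - inner_factor b u ^ n) / of_nat n)"
  have "E \<noteq> 0" by (simp add: E_def)
  moreover have "cis (grid_angle n j) * E = cis (grid_angle n k) * E"
    using u(2) w(2) unfolding \<open>u = w\<close>[symmetric] E_def[symmetric] by (rule HOL.trans[OF sym])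
  ultimately have "cis (grid_angle n j) = cis (grid_angle n k)" by simp
  then show ?thesis by (rule cis_grid_angle_inj[OF n])
qed

text \<open>Zeros of the first kind lie on the cut \<open>[-1, 1]\<close>, zeros of the second kind off it.\<close>

lemma interval_loop_zero_disjoint:
  assumes b: "b < - 1 / 2" and z: "interval_zero b p n j z" "loop_zero b p n k z"
  shows False
proof -
  obtain \<alpha> where \<alpha>: "crit b \<le> cos \<alpha>" "z = of_real (inv_U b (cos \<alpha>))"
    using z(1) unfolding interval_zero_def by blast
  obtain u where u: "1 < norm (of_real b * (1 - u))" "z = joukowski (of_real b * (1 - u))"
    using z(2) unfolding loop_zero_def by blast
  have "inv_U b (cos \<alpha>) \<in> interval_I b" using map_U_inv_U(1)[OF b] \<alpha>(1) by simp
  moreover have "- 1 \<le> 1 / (2 * b)" using b by (simp add: field_simps)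
  ultimately have "\<bar>inv_U b (cos \<alpha>)\<bar> \<le> 1" by (auto simp: interval_I_def)
  moreover have "of_real b * (1 - u) \<noteq> 0" using u(1) by auto
  ultimately have "norm (of_real b * (1 - u)) = 1"
    using joukowski_mem_interval_imp_unit[of "of_real b * (1 - u)" "inv_U b (cos \<alpha>)"] u(2) \<alpha>(2) by simp
  then show False using u(1) by simp
qed

lemma cell_zero_inj:
  assumes "b < - 1 / 2" "j < n" "k < n" "cell_zero b p n j z" "cell_zero b p n k z"
  shows "j = k"
  using assms(4,5) interval_zero_inj[OF assms(1-3)] loop_zero_inj[OF assms(1-3)]
    interval_loop_zero_disjoint[OF assms(1)] unfolding cell_zero_def by metis

lemma cell_zero_is_zero: "cell_zero b p n j z \<Longrightarrow> poly p z = 0"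
  by (auto simp: cell_zero_def interval_zero_def loop_zero_def)

text \<open>The cosine rule in disguise: with \<open>cos \<alpha> = U x\<close>, the number \<open>\<zeta> = r cis \<alpha> + b\<close> has modulus one and
  real part \<open>x\<close>. Then \<open>1 / \<zeta>\<close> is its conjugate, the two factors are conjugate, and the equation
  \<open>u\<^sup>n + v\<^sup>n = 1\<close> is the real equation \<open>2 r\<^sup>n cos (n \<alpha>) = (- b)\<^sup>n\<close>.\<close>

lemma interval_zero_equation:
  fixes R b :: real
  assumes F: "faber_polynomials (airfoil_map R) F" and b: "b = 1 - R" "R \<noteq> 0" "b < - 1 / 2"
    and \<alpha>: "crit b \<le> cos \<alpha>"
  defines "r \<equiv> sqrt (b\<^sup>2 + 1 - 2 * b * inv_U b (cos \<alpha>))"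
  shows "r \<ge> - b"
    and "2 * r ^ n * cos (real n * \<alpha>) = (- b) ^ n \<Longrightarrow> poly (F n) (of_real (inv_U b (cos \<alpha>))) = 0"
proof -
  define x where "x = inv_U b (cos \<alpha>)"
  have x: "x \<in> interval_I b" "map_U b x = cos \<alpha>" using map_U_inv_U[OF b(3)] \<alpha> by (simp_all add: x_def)
  have x1: "1 / (2 * b) \<le> x" using x by (simp add: interval_I_def)
  have rr: "b\<^sup>2 + 1 - 2 * b * x \<ge> b\<^sup>2" by (rule map_U_radicand[OF b(3) x1])
  then have "sqrt (b\<^sup>2) \<le> r" unfolding r_def x_def[symmetric] by (rule real_sqrt_le_mono)
  then show rb: "r \<ge> - b" using b(3) by simp
  have r2: "r\<^sup>2 = b\<^sup>2 + 1 - 2 * b * x"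
    unfolding r_def x_def[symmetric] by (rule real_sqrt_pow2[OF order_trans[OF zero_le_power2 rr]])
  have xc: "x - b = r * cos \<alpha>"
  proof -
    have "(x - b) / r = cos \<alpha>" using x(2) unfolding map_U_def r_def x_def[symmetric] .
    then show ?thesis using rb b(3) by (simp add: divide_eq_eq mult.commute)
  qed
  \<comment> \<open>\<open>w = \<zeta> - b\<close>; the angle \<open>\<alpha>\<close> may exceed \<open>\<pi>\<close>, in which case \<open>\<zeta>\<close> is the root in the lower half plane\<close>
  define w where "w = of_real r * cis \<alpha>"
  define \<zeta> where "\<zeta> = w + of_real b"
  have Re: "Re \<zeta> = x" using xc by (simp add: \<zeta>_def w_def)
  have "(norm \<zeta>)\<^sup>2 = (r * cos \<alpha> + b)\<^sup>2 + (r * sin \<alpha>)\<^sup>2" unfolding cmod_power2 by (simp add: \<zeta>_def w_def)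
  also have "\<dots> = r\<^sup>2 * ((cos \<alpha>)\<^sup>2 + (sin \<alpha>)\<^sup>2) + 2 * b * (r * cos \<alpha>) + b\<^sup>2"
    by (simp only: power2_eq_square algebra_simps)
  also have "\<dots> = 1" unfolding r2 xc[symmetric] by (simp add: power2_eq_square algebra_simps)
  finally have n1: "norm \<zeta> = 1" using power2_eq_iff_nonneg[of "norm \<zeta>" 1] by simp
  then have \<zeta>0: "\<zeta> \<noteq> 0" by auto
  have J: "joukowski \<zeta> = of_real x" using joukowski_unit_circle[OF n1] Re by simp
  have inv: "1 / \<zeta> = cnj \<zeta>" using n1 by (metis complex_div_cnj div_by_1 mult_1 of_real_1 one_power2)
  define u where "u = 1 - \<zeta> / of_real b"
  have u: "u = of_real (r / - b) * cis \<alpha>" using b(3) by (simp add: u_def \<zeta>_def w_def add_divide_distrib)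
  have v: "inner_factor b u = cnj u"
  proof -
    have "inner_factor b u = 1 - (1 / \<zeta>) / of_real b"
      using inner_factor_outer[OF _ \<zeta>0, of b] b(3) by (simp add: u_def mult.commute)
    then show ?thesis unfolding inv u_def by simp
  qed
  have "u ^ n = of_real ((r / - b) ^ n) * cis (real n * \<alpha>)"
    unfolding u power_mult_distrib Complex.DeMoivre by simp
  then have un: "Re (u ^ n) = (r / - b) ^ n * cos (real n * \<alpha>)" by simp
  assume "2 * r ^ n * cos (real n * \<alpha>) = (- b) ^ n"
  then have "2 * ((r / - b) ^ n * cos (real n * \<alpha>)) = 1"
  proof -
    have "2 * ((r / - b) ^ n * cos (real n * \<alpha>)) = (2 * r ^ n * cos (real n * \<alpha>)) / (- b) ^ n"
      unfolding power_divide by simp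
    then show ?thesis unfolding \<open>2 * r ^ n * cos (real n * \<alpha>) = (- b) ^ n\<close> using b(3) by simp
  qed
  then have "u ^ n + inner_factor b u ^ n = 1"
    unfolding v complex_cnj_power[symmetric] complex_add_cnj un by simp
  moreover have "u \<noteq> 1" "of_real b * (1 - u) = \<zeta>" using \<zeta>0 b(3) by (simp_all add: u_def)
  ultimately have "poly (F n) (joukowski \<zeta>) = 0"
    using faber_zero_iff[OF F b(1,2), of u n] b(3) by simp
  then show "poly (F n) (of_real (inv_U b (cos \<alpha>))) = 0" unfolding J x_def .
qed

text \<open>From the left end to the middle of the cell \<open>cos (n s)\<close> runs from \<open>1\<close> to \<open>- 1\<close>. As \<open>r \<ge> - b\<close>, the term
  \<open>2 r\<^sup>n cos (n s)\<close> dominates \<open>(- b)\<^sup>n\<close> at both ends, so the difference changes sign.\<close>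

lemma interval_zero_exists:
  fixes R b :: real
  assumes F: "faber_polynomials (airfoil_map R) F" and b: "b = 1 - R" "R \<noteq> 0" "b < - 1 / 2"
    and n: "n > 0" and cell: "\<And>s. grid_angle n j \<le> s \<Longrightarrow> s \<le> grid_angle n j + pi / real n \<Longrightarrow> crit b \<le> cos s"
  shows "\<exists>z. interval_zero b (F n) n j z"
proof -
  define r where "r s = sqrt (b\<^sup>2 + 1 - 2 * b * inv_U b (cos s))" for s
  define H where "H s = 2 * r s ^ n * cos (real n * s) - (- b) ^ n" for s
  let ?g = "grid_angle n j" and ?h = "grid_angle n j + pi / real n"
  have gh: "?g \<le> ?h" using n by simp
  have rb: "r s \<ge> - b" if "?g \<le> s" "s \<le> ?h" for s
    unfolding r_def by (rule interval_zero_equation(1)[OF F b cell[OF that]])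
  have pow: "r s ^ n \<ge> (- b) ^ n" if "?g \<le> s" "s \<le> ?h" for s
    using rb[OF that] b(3) by (intro power_mono) auto
  have bp: "(- b) ^ n > 0" using b(3) by simp
  have "continuous_on {?g..?h} H"
  proof -
    have "continuous_on {?g..?h} (\<lambda>s. inv_U b (cos s))"
      by (rule continuous_on_compose2[OF continuous_on_inv_U[OF b(3)]])
         (auto intro!: continuous_intros cell)
    then show ?thesis unfolding H_def r_def by (intro continuous_intros)
  qed
  moreover have Hg: "H ?g > 0"
    unfolding H_def cos_sin_n_grid_angle(1)[OF n] using pow[of ?g] gh bp by simp
  moreover have Hh: "H ?h < 0"
    unfolding H_def cos_sin_n_grid_angle(2)[OF n] using pow[of ?h] gh bp by simp
  ultimately obtain \<alpha> where \<alpha>: "?g \<le> \<alpha>" "\<alpha> \<le> ?h" "H \<alpha> = 0"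
    using IVT2'[of H ?h 0 ?g] gh by auto
  then have "?g < \<alpha>" "\<alpha> < ?h" using Hg Hh by (metis less_irrefl order_le_less)+
  moreover have "poly (F n) (of_real (inv_U b (cos \<alpha>))) = 0"
    by (rule interval_zero_equation(2)[OF F b cell[OF \<alpha>(1,2)]])
       (use \<alpha>(3) in \<open>simp add: H_def r_def\<close>)
  ultimately show ?thesis using cell[of ?g] cell[OF \<alpha>(1,2)] gh unfolding interval_zero_def by auto
qed

lemma norm_Ln_one_minus_div_le:
  assumes "norm x < 1 / 2" 
  shows "norm (Ln (1 - x) / of_nat n) \<le> 1 / real n"
proof -
  have "norm (Ln (1 - x)) \<le> 1" using norm_Ln_le[of "- x"] assms by simp
  then show ?thesis by (simp add: norm_divide divide_right_mono)
qed

text \<open>The right-hand side of \<open>u = \<omega> (1 - v\<^sup>n)\<^bsup>1/n\<^esup>\<close> maps the disc to itself because it moves \<open>\<omega>\<close> by a factor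
  \<open>exp \<eta>\<close> with \<open>|\<eta>| \<le> 1 / n\<close>. A fixed point satisfies \<open>u\<^sup>n = 1 - v\<^sup>n\<close> since \<open>\<omega>\<^sup>n = 1\<close>.\<close>

lemma loop_zero_exists:
  fixes R b :: real
  assumes F: "faber_polynomials (airfoil_map R) F" and b: "b = 1 - R" "R \<noteq> 0" "b < - 1 / 2"
    and n: "n > 0" and arc: "cos (grid_angle n j) < crit b"
    and \<rho>: "\<rho> > 0" and out: "\<And>u. u \<in> cball p \<rho> \<Longrightarrow> 1 < norm (of_real b * (1 - u))"
    and inn: "\<And>u. u \<in> cball p \<rho> \<Longrightarrow> norm (inner_factor b u ^ n) < 1 / 2"
    and near: "\<And>\<eta>. norm \<eta> \<le> 1 / real n \<Longrightarrow> cis (grid_angle n j) * exp \<eta> \<in> cball p \<rho>"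
  shows "\<exists>z. loop_zero b (F n) n j z"
proof -
  define G where "G u = cis (grid_angle n j) * exp (Ln (1 - inner_factor b u ^ n) / of_nat n)" for u
  have u1: "u \<noteq> 1" if "u \<in> cball p \<rho>" for u using out[OF that] by auto
  have "continuous_on (cball p \<rho>) (inner_factor b)"
    unfolding inner_factor_def using u1 b(3) by (intro continuous_intros) auto
  moreover have "1 - inner_factor b u ^ n \<notin> \<real>\<^sub>\<le>\<^sub>0" if "u \<in> cball p \<rho>" for u
  proof -
    have "Re (inner_factor b u ^ n) < 1"
      using inn[OF that] complex_Re_le_cmod[of "inner_factor b u ^ n"] by linarith
    then show ?thesis by (auto simp: complex_nonpos_Reals_iff)
  qed
  ultimately have "continuous_on (cball p \<rho>) G"
    unfolding G_def using n by (intro continuous_intros) auto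
  moreover have "G \<in> cball p \<rho> \<rightarrow> cball p \<rho>"
  proof
    fix u assume "u \<in> cball p \<rho>"
    then have "norm (Ln (1 - inner_factor b u ^ n) / of_nat n) \<le> 1 / real n"
      using norm_Ln_one_minus_div_le[OF inn] by blast
    then show "G u \<in> cball p \<rho>" unfolding G_def by (rule near)
  qed
  ultimately obtain u where u: "u \<in> cball p \<rho>" "G u = u"
    using brouwer[of "cball p \<rho>" G] \<rho> by (auto simp: cball_eq_empty)
  have "u ^ n = cis (grid_angle n j) ^ n * exp (Ln (1 - inner_factor b u ^ n) / of_nat n) ^ n"
    using u(2) unfolding G_def by (metis power_mult_distrib)
  also have "\<dots> = exp (Ln (1 - inner_factor b u ^ n))"
    unfolding cos_sin_n_grid_angle(4)[OF n] using n by (simp flip: exp_of_nat_mult)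
  also have "\<dots> = 1 - inner_factor b u ^ n"
    using inn[OF u(1)] by (intro exp_Ln) auto
  finally have "u ^ n + inner_factor b u ^ n = 1" by simp
  then have "poly (F n) (joukowski (of_real b * (1 - u))) = 0"
    using faber_zero_iff[OF F b(1,2) _ u1[OF u(1)], of n] b(3) by simp
  then show ?thesis
    unfolding loop_zero_def using arc out[OF u(1)] inn[OF u(1)] u(2) unfolding G_def by metis
qed

section \<open>From cells to the limit distribution\<close>

lemma tendsto_grid_angle:
  assumes "0 \<le> t"
  shows "(\<lambda>n. grid_angle n (cell_index n t)) \<longlonglongrightarrow> t"
proof (rule tendsto_sandwich)
  show "\<forall>\<^sub>F n in sequentially. t - 2 * pi / real n \<le> grid_angle n (cell_index n t)"
    using eventually_gt_at_top[of 0]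
  proof eventually_elim
    case (elim n)
    then show ?case using cell_index_bounds(2)[OF elim assms] by simp
  qed
  show "\<forall>\<^sub>F n in sequentially. grid_angle n (cell_index n t) \<le> t"
    using eventually_gt_at_top[of 0]
    by eventually_elim (rule cell_index_bounds(1)[OF _ assms])
  have "(\<lambda>n. t - 2 * pi / real n) \<longlonglongrightarrow> t - 0"
    by (intro tendsto_intros lim_const_over_n)
  then show "(\<lambda>n. t - 2 * pi / real n) \<longlonglongrightarrow> t" by simp
qed auto

lemma eventually_inverse_less:
  assumes "\<delta> > 0"
  shows "\<forall>\<^sub>F n in sequentially. n > 0 \<and> c / real n < \<delta>"
  using eventually_conj[OF eventually_gt_at_top[of 0] order_tendstoD(2)[OF lim_const_over_n[of c] assms]] .

text \<open>Solutions for the cell of \<open>t\<close> have the form \<open>\<omega> exp \<eta>\<close> with \<open>|\<eta>| \<le> 1 / n\<close>. This serves both to map a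
  small disc to itself and to see that solutions converge.\<close>

lemma eventually_rotated_exp_near:
  assumes t: "0 \<le> t" and \<rho>: "\<rho> > 0"
  shows "\<forall>\<^sub>F n in sequentially. \<forall>\<eta>. norm \<eta> \<le> 1 / real n \<longrightarrow>
           dist (cis (grid_angle n (cell_index n t)) * exp \<eta>) (cis t) < \<rho>"
proof -
  have "isCont exp (0 :: complex)" by simp
  then obtain \<epsilon> where \<epsilon>: "\<epsilon> > 0" "\<And>\<eta>::complex. norm \<eta> < \<epsilon> \<Longrightarrow> dist (exp \<eta>) 1 < \<rho> / 2"
    using \<rho> unfolding continuous_at_eps_delta by (metis dist_0_norm dist_commute exp_zero half_gt_zero)
  have "\<forall>\<^sub>F n in sequentially. dist (cis (grid_angle n (cell_index n t))) (cis t) < \<rho> / 2"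
    by (rule tendstoD[OF tendsto_cis[OF tendsto_grid_angle[OF t]]]) (use \<rho> in simp)
  then show ?thesis using eventually_inverse_less[OF \<epsilon>(1), of 1]
  proof eventually_elim
    case (elim n)
    show ?case
    proof (intro allI impI)
      fix \<eta> :: complex assume "norm \<eta> \<le> 1 / real n"
      then have e: "dist (exp \<eta>) 1 < \<rho> / 2" using elim \<epsilon>(2) by auto
      let ?c = "cis (grid_angle n (cell_index n t))"
      have "?c * exp \<eta> - ?c = ?c * (exp \<eta> - 1)" by (simp add: algebra_simps)
      then have "dist (?c * exp \<eta>) ?c = dist (exp \<eta>) 1" by (simp add: dist_norm norm_mult)
      then show "dist (?c * exp \<eta>) (cis t) < \<rho>"
        using e elim(1) dist_triangle[of "?c * exp \<eta>" "cis t" ?c] by simp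
    qed
  qed
qed

text \<open>The cell of \<open>t\<close> shrinks to \<open>t\<close>, so the strict inequality at \<open>t\<close> holds on the whole cell.\<close>

lemma eventually_interval_zero:
  fixes R b :: real
  assumes F: "faber_polynomials (airfoil_map R) F" and b: "b = 1 - R" "R \<noteq> 0" "b < - 1 / 2"
    and t: "0 \<le> t" "crit b < cos t"
  shows "\<forall>\<^sub>F n in sequentially. \<exists>z. interval_zero b (F n) n (cell_index n t) z"
proof -
  have "\<forall>\<^sub>F s in nhds t. crit b < cos s"
    by (rule order_tendstoD(1)[OF _ t(2)]) (auto intro!: tendsto_intros filterlim_ident)
  then obtain \<delta> where \<delta>: "\<delta> > 0" "\<And>s. dist s t < \<delta> \<Longrightarrow> crit b < cos s"
    unfolding eventually_nhds_metric by blast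
  show ?thesis using eventually_inverse_less[OF \<delta>(1), of "2 * pi"]
  proof eventually_elim
    case (elim n)
    then have n: "n > 0" by simp
    have hp: "pi / real n < 2 * pi / real n" using n by (simp add: divide_strict_right_mono)
    show ?case
    proof (rule interval_zero_exists[OF F b n])
      fix s assume "grid_angle n (cell_index n t) \<le> s" "s \<le> grid_angle n (cell_index n t) + pi / real n"
      then have "dist s t < \<delta>"
        using cell_index_bounds[OF n t(1)] elim hp unfolding dist_real_def by linarith
      then show "crit b \<le> cos s" using \<delta>(2) by (simp add: less_imp_le)
    qed
  qed
qed

text \<open>On a small disc around \<open>cis t\<close> the second factor stays below some \<open>q < 1\<close>; its powers are then
  uniformly small.\<close>

lemma eventually_loop_zero:
  fixes R b :: real
  assumes F: "faber_polynomials (airfoil_map R) F" and b: "b = 1 - R" "R \<noteq> 0" "b < - 1 / 2"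
    and t: "0 \<le> t" "cos t < crit b"
  shows "\<forall>\<^sub>F n in sequentially. \<exists>z. loop_zero b (F n) n (cell_index n t) z"
proof -
  define p where "p = cis t"
  have p: "norm (of_real b * (1 - p)) > 1" "norm (inner_factor b p) < 1"
    using loop_parameter_bounds[of b p] b(3) t(2) by (simp_all add: p_def)
  then have p1: "p \<noteq> 1" by auto
  obtain q where q: "norm (inner_factor b p) < q" "q < 1" using dense p(2) by blast
  then have q0: "q \<ge> 0" by (smt (verit) norm_ge_zero)
  have "isCont (inner_factor b) p"
    unfolding inner_factor_def using p1 b(3) by (intro continuous_intros) auto
  then have "(inner_factor b \<longlongrightarrow> inner_factor b p) (nhds p)"
    by (simp add: isCont_def tendsto_at_iff_tendsto_nhds)
  then have "\<forall>\<^sub>F u in nhds p. norm (inner_factor b u) < q"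
    by (rule order_tendstoD(2)[OF tendsto_norm q(1)])
  moreover have "\<forall>\<^sub>F u in nhds p. 1 < norm (of_real b * (1 - u))"
    by (rule order_tendstoD(1)[OF _ p(1)]) (auto intro!: tendsto_intros filterlim_ident)
  ultimately have "\<forall>\<^sub>F u in nhds p. norm (inner_factor b u) < q \<and> 1 < norm (of_real b * (1 - u))"
    by (rule eventually_conj)
  then obtain d where d: "d > 0"
    "\<And>u. dist u p < d \<Longrightarrow> norm (inner_factor b u) < q \<and> 1 < norm (of_real b * (1 - u))"
    unfolding eventually_nhds_metric by blast
  define \<rho> where "\<rho> = d / 2"
  have \<rho>: "\<rho> > 0" using d(1) by (simp add: \<rho>_def)
  have ball: "norm (inner_factor b u) < q" "1 < norm (of_real b * (1 - u))" if "u \<in> cball p \<rho>" for u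
  proof -
    have "dist u p < d" using that d(1) by (simp add: \<rho>_def dist_commute)
    then show "norm (inner_factor b u) < q" "1 < norm (of_real b * (1 - u))" using d(2) by auto
  qed
  have "(\<lambda>n. q ^ n) \<longlonglongrightarrow> 0" using q0 q(2) by (intro LIMSEQ_power_zero) simp
  then have "\<forall>\<^sub>F n in sequentially. q ^ n < 1 / 2" by (rule order_tendstoD(2)) simp
  moreover have "\<forall>\<^sub>F n in sequentially. cos (grid_angle n (cell_index n t)) < crit b"
    by (rule order_tendstoD(2)[OF tendsto_cos[OF tendsto_grid_angle[OF t(1)]] t(2)])
  moreover note eventually_rotated_exp_near[OF t(1) \<rho>] eventually_gt_at_top[of 0]
  ultimately show ?thesis
  proof eventually_elim
    case (elim n)
    show ?case
    proof (rule loop_zero_exists[OF F b elim(4) elim(2) \<rho>, where p = p])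
      fix u assume u: "u \<in> cball p \<rho>"
      show "1 < norm (of_real b * (1 - u))" by (rule ball(2)[OF u])
      have "norm (inner_factor b u ^ n) \<le> q ^ n"
        unfolding norm_power using ball(1)[OF u] by (intro power_mono) auto
      then show "norm (inner_factor b u ^ n) < 1 / 2" using elim(1) by linarith
    next
      fix \<eta> :: complex assume "norm \<eta> \<le> 1 / real n"
      then show "cis (grid_angle n (cell_index n t)) * exp \<eta> \<in> cball p \<rho>"
        using elim(3) by (auto simp: p_def dist_commute less_imp_le)
    qed
  qed
qed

lemma interval_zero_converges:
  assumes b: "b < - 1 / 2" and t: "0 \<le> t" "crit b < cos t" and e: "e > 0"
  shows "\<forall>\<^sub>F n in sequentially. \<forall>z. cell_zero b (F n) n (cell_index n t) z \<longrightarrow> dist z (limit_curve b t) < e"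
proof -
  define S where "S = {s. crit b \<le> cos s}"
  have "continuous_on S (\<lambda>s. inv_U b (cos s))"
    by (rule continuous_on_compose2[OF continuous_on_inv_U[OF b]])
       (auto intro!: continuous_intros simp: S_def)
  moreover have "t \<in> S" using t by (simp add: S_def)
  ultimately obtain \<delta> where \<delta>: "\<delta> > 0" "\<And>s. s \<in> S \<Longrightarrow> dist s t < \<delta> \<Longrightarrow> dist (inv_U b (cos s)) (inv_U b (cos t)) < e"
    unfolding continuous_on_iff using e by metis
  have "\<forall>\<^sub>F n in sequentially. crit b < cos (grid_angle n (cell_index n t))"
    by (rule order_tendstoD(1)[OF tendsto_cos[OF tendsto_grid_angle[OF t(1)]] t(2)])
  then show ?thesis using eventually_inverse_less[OF \<delta>(1), of "2 * pi"]
  proof eventually_elim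
    case (elim n)
    then have n: "n > 0" by simp
    have hp: "pi / real n < 2 * pi / real n" using n by (simp add: divide_strict_right_mono)
    show ?case
    proof (intro allI impI)
      fix z assume "cell_zero b (F n) n (cell_index n t) z"
      then have "interval_zero b (F n) n (cell_index n t) z"
        using elim(1) by (auto simp: cell_zero_def loop_zero_def)
      then obtain \<alpha> where \<alpha>: "grid_angle n (cell_index n t) < \<alpha>"
        "\<alpha> < grid_angle n (cell_index n t) + pi / real n" "crit b \<le> cos \<alpha>" "z = of_real (inv_U b (cos \<alpha>))"
        unfolding interval_zero_def by blast
      have "dist \<alpha> t < \<delta>"
        using cell_index_bounds[OF n t(1)] elim hp \<alpha>(1,2) unfolding dist_real_def by linarith
      then have "dist (inv_U b (cos \<alpha>)) (inv_U b (cos t)) < e" using \<delta>(2) \<alpha>(3) by (simp add: S_def)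
      then show "dist z (limit_curve b t) < e"
        unfolding limit_curve_def \<alpha>(4) using t(2) by (simp add: dist_of_real)
    qed
  qed
qed

lemma loop_zero_converges:
  assumes b: "b < - 1 / 2" and t: "0 \<le> t" "cos t < crit b" and e: "e > 0"
  shows "\<forall>\<^sub>F n in sequentially. \<forall>z. cell_zero b (F n) n (cell_index n t) z \<longrightarrow> dist z (limit_curve b t) < e"
proof -
  define p where "p = cis t"
  have "norm (of_real b * (1 - p)) > 1"
    using loop_parameter_bounds(1)[of b p] b t(2) by (simp add: p_def)
  then have "of_real b * (1 - p) \<noteq> 0" by auto
  then have "isCont (\<lambda>u. joukowski (of_real b * (1 - u))) p"
    unfolding joukowski_def by (intro continuous_intros) auto
  then obtain \<delta> where \<delta>: "\<delta> > 0" "\<And>u. dist u p < \<delta> \<Longrightarrow>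
      dist (joukowski (of_real b * (1 - u))) (joukowski (of_real b * (1 - p))) < e"
    using e unfolding continuous_at_eps_delta by blast
  have "\<forall>\<^sub>F n in sequentially. cos (grid_angle n (cell_index n t)) < crit b"
    by (rule order_tendstoD(2)[OF tendsto_cos[OF tendsto_grid_angle[OF t(1)]] t(2)])
  then show ?thesis using eventually_rotated_exp_near[OF t(1) \<delta>(1)]
  proof eventually_elim
    case (elim n)
    show ?case
    proof (intro allI impI)
      fix z assume "cell_zero b (F n) n (cell_index n t) z"
      then have "loop_zero b (F n) n (cell_index n t) z"
        using elim(1) by (auto simp: cell_zero_def interval_zero_def)
      then obtain u where u: "norm (inner_factor b u ^ n) < 1 / 2"
          "u = cis (grid_angle n (cell_index n t)) * exp (Ln (1 - inner_factor b u ^ n) / of_nat n)"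
          "z = joukowski (of_real b * (1 - u))"
        unfolding loop_zero_def by blast
      have "dist u p < \<delta>"
        using elim(2) norm_Ln_one_minus_div_le[OF u(1), of n] u(2) unfolding p_def by metis
      then show "dist z (limit_curve b t) < e"
        using \<delta>(2) u(3) t(2) by (simp add: limit_curve_def p_def)
    qed
  qed
qed

lemma measurable_cell_index [measurable]: "cell_index n \<in> measurable borel (count_space UNIV)"
  unfolding cell_index_def by measurable

lemma AE_uniform_angle_range: "AE t in uniform_angle. 0 \<le> t \<and> t < 2 * pi"
proof -
  have "AE t in uniform_measure lborel {0..<2 * pi}. t \<in> {0..<2 * pi}"
    by (rule AE_uniform_measureI) auto
  then show ?thesis by (simp only: uniform_angle_def atLeastLessThan_iff)
qed

lemma integral_cell_index:
  fixes h :: "nat \<Rightarrow> real"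
  assumes n: "n > 0"
  shows "(\<integral>t. h (cell_index n t) \<partial>uniform_angle) = (\<Sum>j<n. h j) / real n"
proof -
  interpret prob_space uniform_angle by (rule prob_space_uniform_angle)
  define I where "I j = {grid_angle n j..<grid_angle n (Suc j)}" for j
  have mI: "measure uniform_angle (I j) = 1 / real n" if "j < n" for j
  proof -
    have "{0..<2 * pi} \<inter> I j = I j"
      using grid_angle_bounds[OF that] by (auto simp: I_def grid_angle_Suc)
    then have "emeasure uniform_angle (I j) = emeasure lborel (I j) / ennreal (2 * pi)"
      by (simp add: emeasure_uniform_angle I_def)
    also have "emeasure lborel (I j) = ennreal (2 * pi / real n)"
      using n by (simp add: I_def grid_angle_Suc)
    also have "ennreal (2 * pi / real n) / ennreal (2 * pi) = ennreal (1 / real n)"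
      using n by (simp add: divide_ennreal)
    finally show ?thesis by (simp add: measure_def)
  qed
  have "(\<integral>t. h (cell_index n t) \<partial>uniform_angle) = (\<integral>t. (\<Sum>j<n. h j * indicator (I j) t) \<partial>uniform_angle)"
  proof (rule integral_cong_AE)
    show "AE t in uniform_angle. h (cell_index n t) = (\<Sum>j<n. h j * indicator (I j) t)"
      using AE_uniform_angle_range
    proof eventually_elim
      case (elim t)
      have ind: "indicator (I j) t = (if cell_index n t = j then 1 else 0 :: real)" for j
        using cell_index_iff[OF n, of t j] elim by (auto simp: I_def indicator_def)
      have "(\<Sum>j<n. h j * indicator (I j) t) = (\<Sum>j<n. if cell_index n t = j then h j else 0)"
        unfolding ind by (intro sum.cong refl) simp
      also have "\<dots> = h (cell_index n t)"
        using cell_index_less[OF n, of t] elim by simp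
      finally show ?case ..
    qed
    have [measurable]: "I j \<in> sets borel" for j by (simp add: I_def)
    show "(\<lambda>t. h (cell_index n t)) \<in> borel_measurable uniform_angle" by measurable
    show "(\<lambda>t. \<Sum>j<n. h j * indicator (I j) t) \<in> borel_measurable uniform_angle" by measurable
  qed
  also have "\<dots> = (\<Sum>j<n. h j * measure uniform_angle (I j))"
  proof -
    have int: "integrable uniform_angle (\<lambda>t. h j * indicator (I j) t)" for j
      by (intro integrable_mult_right integrable_real_indicator) (auto simp: I_def less_top[symmetric])
    have "(\<integral>t. (\<Sum>j<n. h j * indicator (I j) t) \<partial>uniform_angle)
        = (\<Sum>j<n. \<integral>t. h j * indicator (I j) t \<partial>uniform_angle)"
      by (rule Bochner_Integration.integral_sum) (rule int)
    then show ?thesis by simp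
  qed
  also have "\<dots> = (\<Sum>j<n. h j) / real n"
    by (simp add: mI sum_divide_distrib)
  finally show ?thesis .
qed

lemma integral_normalized_zero_measure:
  fixes f :: "complex \<Rightarrow> real"
  assumes f: "continuous_on UNIV f" and p: "proots p \<noteq> {#}"
  shows "integral\<^sup>L (normalized_zero_measure p) f
       = (\<Sum>z\<in>set_mset (proots p). f z * (real (count (proots p) z) / real (size (proots p))))"
proof -
  have [measurable]: "f \<in> borel_measurable borel" by (rule borel_measurable_continuous_onI[OF f])
  have "integral\<^sup>L (normalized_zero_measure p) f = (\<integral>z. f z \<partial>measure_pmf (pmf_of_multiset (proots p)))"
    unfolding normalized_zero_measure_def by (subst integral_distr) auto
  also have "\<dots> = (\<Sum>z\<in>set_mset (proots p). f z * pmf (pmf_of_multiset (proots p)) z)"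
    by (rule integral_measure_pmf_real) (use set_pmf_of_multiset[OF p] in auto)
  finally show ?thesis unfolding pmf_of_multiset[OF p] .
qed

text \<open>Each exhibited zero has mass at least \<open>1 / n\<close> because there are at most \<open>n\<close> zeros in total. Zeros
  that were not exhibited only increase the integral.\<close>

lemma zero_measure_lower_bound:
  fixes f :: "complex \<Rightarrow> real"
  assumes f: "continuous_on UNIV f" "\<And>z. f z \<ge> 0" and p: "p \<noteq> 0" "degree p \<le> n"
    and D: "finite D" "D \<noteq> {}" and w: "inj_on w D" "\<And>j. j \<in> D \<Longrightarrow> poly p (w j) = 0"
  shows "(\<Sum>j\<in>D. f (w j)) / real n \<le> integral\<^sup>L (normalized_zero_measure p) f"
proof -
  have sub: "w ` D \<subseteq> set_mset (proots p)" using w(2) p(1) by (auto simp: set_count_proots)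
  then have ne: "proots p \<noteq> {#}" using D(2) by auto
  have sz: "0 < size (proots p)" "size (proots p) \<le> n"
    using ne nonempty_has_size size_proots_le[of p] p(2) by auto
  have "(\<Sum>j\<in>D. f (w j)) / real n = (\<Sum>z\<in>w ` D. f z * (1 / real n))"
    by (simp add: sum.reindex[OF w(1)] sum_divide_distrib)
  also have "\<dots> \<le> (\<Sum>z\<in>w ` D. f z * (real (count (proots p) z) / real (size (proots p))))"
  proof (intro sum_mono mult_left_mono f(2) frac_le)
    fix z assume "z \<in> w ` D"
    then have "z \<in># proots p" using sub by blast
    then show "1 \<le> real (count (proots p) z)" by (metis Suc_leI count_greater_zero_iff of_nat_1 of_nat_le_iff One_nat_def)
  qed (use sz in auto)
  also have "\<dots> \<le> (\<Sum>z\<in>set_mset (proots p). f z * (real (count (proots p) z) / real (size (proots p))))"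
    by (rule sum_mono2) (use sub f(2) in auto)
  finally show ?thesis unfolding integral_normalized_zero_measure[OF f(1) ne] .
qed

lemma prob_space_normalized_zero_measure: "prob_space (normalized_zero_measure p)"
  unfolding normalized_zero_measure_def by (intro measure_pmf.prob_space_distr) simp

lemma bounded_of_compact_support:
  fixes f :: "'a :: topological_space \<Rightarrow> real"
  assumes "continuous_on UNIV f" "compact (closure {z. f z \<noteq> 0})"
  obtains M where "\<And>z. \<bar>f z\<bar> \<le> M"
proof -
  have "compact (f ` closure {z. f z \<noteq> 0})"
    by (rule compact_continuous_image[OF continuous_on_subset[OF assms(1)] assms(2)]) simp
  then have "bounded (f ` closure {z. f z \<noteq> 0})" by (rule compact_imp_bounded)
  then obtain M where M: "\<forall>y \<in> f ` closure {z. f z \<noteq> 0}. norm y \<le> M"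
    unfolding bounded_iff by (rule exE)
  have "\<bar>f z\<bar> \<le> \<bar>M\<bar>" for z
  proof (cases "f z = 0")
    case False
    then have "z \<in> closure {z. f z \<noteq> 0}" using closure_subset[of "{z. f z \<noteq> 0}"] by auto
    then show ?thesis using M by auto
  qed simp
  then show ?thesis by (rule that)
qed

text \<open>A criterion for the limit distribution of zeros. Suppose that zeros are attached injectively to the
  cells of the circle, and that for almost every angle the zero of its cell eventually exists and
  tends to \<open>Z t\<close>. Then the attached zeros carry all the mass in the limit, since there are about as many of them
  as the degree permits.\<close>

proposition zero_measure_limit_from_cells:
  fixes f :: "complex \<Rightarrow> real" and p :: "nat \<Rightarrow> complex poly" and C :: "nat \<Rightarrow> nat \<Rightarrow> complex \<Rightarrow> bool" and Z :: "real \<Rightarrow> complex"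
  assumes p: "\<And>n. p n \<noteq> 0" "\<And>n. degree (p n) \<le> n"
    and zero: "\<And>n j z. C n j z \<Longrightarrow> poly (p n) z = 0"
    and inj: "\<And>n j k z. j < n \<Longrightarrow> k < n \<Longrightarrow> C n j z \<Longrightarrow> C n k z \<Longrightarrow> j = k"
    and ex: "AE t in uniform_angle. \<forall>\<^sub>F n in sequentially. \<exists>z. C n (cell_index n t) z"
    and conv: "AE t in uniform_angle. \<forall>e>0. \<forall>\<^sub>F n in sequentially. \<forall>z. C n (cell_index n t) z \<longrightarrow> dist z (Z t) < e"
    and Z [measurable]: "Z \<in> borel_measurable borel"
    and f: "continuous_on UNIV f" "\<And>z. \<bar>f z\<bar> \<le> M"
  shows "(\<lambda>n. integral\<^sup>L (normalized_zero_measure (p n)) f) \<longlonglongrightarrow> (\<integral>t. f (Z t) \<partial>uniform_angle)"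
proof -
  interpret U: prob_space uniform_angle by (rule prob_space_uniform_angle)
  have U1: "measure uniform_angle UNIV = 1" using U.prob_space by simp
  define w where "w n j = (SOME z. C n j z)" for n j
  define D where "D n = {j. j < n \<and> (\<exists>z. C n j z)}" for n
  have w: "C n j (w n j)" if "\<exists>z. C n j z" for n j
    unfolding w_def using that by (rule someI_ex)
  have finD: "finite (D n)" for n unfolding D_def by auto
  have injw: "inj_on (w n) (D n)" for n
  proof (rule inj_onI)
    fix j k assume jk: "j \<in> D n" "k \<in> D n" "w n j = w n k"
    then have "C n j (w n j)" "C n k (w n j)" using w[of n j] w[of n k] by (auto simp: D_def)
    then show "j = k" using inj[of j n k] jk by (auto simp: D_def)
  qed
  define A where "A g n = (\<Sum>j\<in>D n. g (w n j)) / real n" for g :: "complex \<Rightarrow> real" and n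
  have A_lim: "A g \<longlonglongrightarrow> (\<integral>t. g (Z t) \<partial>uniform_angle)"
    if g: "continuous_on UNIV g" "\<And>z. \<bar>g z\<bar> \<le> K" for g K
  proof -
    have [measurable]: "g \<in> borel_measurable borel" by (rule borel_measurable_continuous_onI[OF g(1)])
    define s where "s n t = (if cell_index n t \<in> D n then g (w n (cell_index n t)) else 0)" for n t
    have sm: "s n \<in> borel_measurable uniform_angle" for n
    proof -
      have "(\<lambda>t. (\<lambda>j. if j \<in> D n then g (w n j) else 0) (cell_index n t)) \<in> borel_measurable borel"
        by (rule measurable_compose[OF measurable_cell_index]) simp
      then show ?thesis unfolding s_def by (simp add: measurable_cong_sets[OF sets_uniform_angle refl])
    qed
    have "(\<lambda>n. \<integral>t. s n t \<partial>uniform_angle) \<longlonglongrightarrow> (\<integral>t. g (Z t) \<partial>uniform_angle)"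
    proof (rule integral_dominated_convergence[where w = "\<lambda>_. K"])
      have "K \<ge> 0" using g(2)[of 0] by linarith
      then show "AE t in uniform_angle. norm (s n t) \<le> K" for n
        using g(2) by (auto simp: s_def)
      show "AE t in uniform_angle. (\<lambda>n. s n t) \<longlonglongrightarrow> g (Z t)"
        using ex conv AE_uniform_angle_range
      proof eventually_elim
        case (elim t)
        have "(\<lambda>n. w n (cell_index n t)) \<longlonglongrightarrow> Z t"
        proof (rule tendstoI)
          fix e :: real assume "e > 0"
          then have "\<forall>\<^sub>F n in sequentially. \<forall>z. C n (cell_index n t) z \<longrightarrow> dist z (Z t) < e"
            using elim(2) by blast
          then show "\<forall>\<^sub>F n in sequentially. dist (w n (cell_index n t)) (Z t) < e"
            using elim(1) by eventually_elim (use w in blast)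
        qed
        then have lim: "(\<lambda>n. g (w n (cell_index n t))) \<longlonglongrightarrow> g (Z t)"
          using continuous_on_tendsto_compose[OF g(1)] by simp
        have "\<forall>\<^sub>F n in sequentially. g (w n (cell_index n t)) = s n t"
          using elim(1) eventually_gt_at_top[of 0]
        proof eventually_elim
          case (elim n)
          then show ?case using cell_index_less[of n t] \<open>0 \<le> t \<and> t < 2 * pi\<close> by (simp add: s_def D_def)
        qed
        then show ?case by (rule Lim_transform_eventually[OF lim])
      qed
    qed (use sm in \<open>auto simp: measurable_cong_sets[OF sets_uniform_angle refl]\<close>)
    moreover have "\<forall>\<^sub>F n in sequentially. (\<integral>t. s n t \<partial>uniform_angle) = A g n"
      using eventually_gt_at_top[of 0]
    proof eventually_elim
      case (elim n)
      have "(\<integral>t. s n t \<partial>uniform_angle) = (\<Sum>j<n. if j \<in> D n then g (w n j) else 0) / real n"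
        unfolding s_def by (rule integral_cell_index[OF elim])
      also have "(\<Sum>j<n. if j \<in> D n then g (w n j) else 0) = (\<Sum>j\<in>D n. g (w n j))"
        by (rule sum.mono_neutral_cong_right) (auto simp: D_def)
      finally show ?case by (simp add: A_def)
    qed
    ultimately show ?thesis by (rule Lim_transform_eventually)
  qed
  have fm [measurable]: "f \<in> borel_measurable borel" by (rule borel_measurable_continuous_onI[OF f(1)])
  \<comment> \<open>for \<open>f = 1\<close> the limit is \<open>1\<close>, so eventually some zero has been exhibited\<close>
  have "A (\<lambda>_. 1) \<longlonglongrightarrow> (\<integral>t. 1 \<partial>uniform_angle)" by (rule A_lim[of _ 1]) auto
  then have "\<forall>\<^sub>F n in sequentially. A (\<lambda>_. 1) n > 0" by (rule order_tendstoD(1)) (simp add: U1)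
  then have neD: "\<forall>\<^sub>F n in sequentially. D n \<noteq> {}"
    by eventually_elim (auto simp: A_def)
  \<comment> \<open>the bound needs a nonnegative function, which \<open>M + f\<close> and \<open>M - f\<close> are\<close>
  have low: "A g n \<le> integral\<^sup>L (normalized_zero_measure (p n)) g"
    if "D n \<noteq> {}" "continuous_on UNIV g" "\<And>z. g z \<ge> 0" for g n
    unfolding A_def
    by (rule zero_measure_lower_bound[OF that(2,3) p finD that(1) injw])
       (auto simp: D_def intro!: zero w)
  have f1: "\<bar>M + f z\<bar> \<le> 2 * M" "\<bar>M - f z\<bar> \<le> 2 * M" "M + f z \<ge> 0" "M - f z \<ge> 0" for z
    using f(2)[of z] by linarith+
  have int_f: "integrable N f" if "prob_space N" "sets N = sets borel" for N
  proof -
    interpret prob_space N by (rule that(1))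
    show ?thesis
    proof (rule integrable_const_bound)
      show "AE x in N. norm (f x) \<le> M" using f(2) by simp
      show "f \<in> borel_measurable N" using fm by (simp only: measurable_cong_sets[OF that(2) refl])
    qed
  qed
  have nz: "integrable (normalized_zero_measure (p n)) f" "prob_space (normalized_zero_measure (p n))" for n
    by (rule int_f[OF prob_space_normalized_zero_measure], simp add: normalized_zero_measure_def,
        rule prob_space_normalized_zero_measure)
  have shift: "integral\<^sup>L (normalized_zero_measure (p n)) (\<lambda>z. M + f z) = M + integral\<^sup>L (normalized_zero_measure (p n)) f"
    "integral\<^sup>L (normalized_zero_measure (p n)) (\<lambda>z. M - f z) = M - integral\<^sup>L (normalized_zero_measure (p n)) f" for n
  proof -
    interpret prob_space "normalized_zero_measure (p n)" by (rule nz)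
    show "integral\<^sup>L (normalized_zero_measure (p n)) (\<lambda>z. M + f z) = M + integral\<^sup>L (normalized_zero_measure (p n)) f"
      "integral\<^sup>L (normalized_zero_measure (p n)) (\<lambda>z. M - f z) = M - integral\<^sup>L (normalized_zero_measure (p n)) f"
      using nz(1)[of n] by (simp_all add: prob_space)
  qed
  have fZ: "integrable uniform_angle (\<lambda>t. f (Z t))"
    by (rule U.integrable_const_bound[of _ M])
       (use f(2) in \<open>auto simp: measurable_cong_sets[OF sets_uniform_angle refl]\<close>)
  show ?thesis
  proof (rule tendsto_sandwich)
    show "\<forall>\<^sub>F n in sequentially. A (\<lambda>z. M + f z) n - M \<le> integral\<^sup>L (normalized_zero_measure (p n)) f"
      using neD
    proof eventually_elim
      case (elim n)
      have "A (\<lambda>z. M + f z) n \<le> integral\<^sup>L (normalized_zero_measure (p n)) (\<lambda>z. M + f z)"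
        by (rule low[OF elim]) (use f1 in \<open>auto intro!: continuous_intros f(1)\<close>)
      then show ?case unfolding shift by simp
    qed
    show "\<forall>\<^sub>F n in sequentially. integral\<^sup>L (normalized_zero_measure (p n)) f \<le> M - A (\<lambda>z. M - f z) n"
      using neD
    proof eventually_elim
      case (elim n)
      have "A (\<lambda>z. M - f z) n \<le> integral\<^sup>L (normalized_zero_measure (p n)) (\<lambda>z. M - f z)"
        by (rule low[OF elim]) (use f1 in \<open>auto intro!: continuous_intros f(1)\<close>)
      then show ?case unfolding shift by simp
    qed
    have "(\<lambda>n. A (\<lambda>z. M + f z) n - M) \<longlonglongrightarrow> (\<integral>t. M + f (Z t) \<partial>uniform_angle) - M"
      by (intro tendsto_intros A_lim[of _ "2 * M"]) (use f1 in \<open>auto intro!: continuous_intros f(1)\<close>)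
    then show "(\<lambda>n. A (\<lambda>z. M + f z) n - M) \<longlonglongrightarrow> (\<integral>t. f (Z t) \<partial>uniform_angle)"
      using fZ by (simp add: U1)
    have "(\<lambda>n. M - A (\<lambda>z. M - f z) n) \<longlonglongrightarrow> M - (\<integral>t. M - f (Z t) \<partial>uniform_angle)"
      by (intro tendsto_intros A_lim[of _ "2 * M"]) (use f1 in \<open>auto intro!: continuous_intros f(1)\<close>)
    then show "(\<lambda>n. M - A (\<lambda>z. M - f z) n) \<longlonglongrightarrow> (\<integral>t. f (Z t) \<partial>uniform_angle)"
      using fZ by (simp add: U1)
  qed
qed

text \<open>The excluded angles are \<open>arccos (crit b)\<close> and its reflection, the two preimages of the crossing point.\<close>

lemma AE_cos_not_crit:
  assumes b: "b < - 1 / 2"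
  shows "AE t in uniform_angle. cos t \<noteq> crit b"
proof -
  define a where "a = arccos (crit b)"
  have a: "0 \<le> a" "a \<le> pi" "cos a = crit b"
    using crit_bounds[OF b] by (auto simp: a_def arccos_lbound arccos_ubound)
  have "AE t in lborel. t \<noteq> a" "AE t in lborel. t \<noteq> 2 * pi - a" by (simp_all add: AE_lborel_singleton)
  then have "AE t in lborel. t \<in> {0..<2 * pi} \<longrightarrow> cos t \<noteq> crit b"
  proof eventually_elim
    case (elim t)
    show ?case
    proof
      assume t: "t \<in> {0..<2 * pi}"
      show "cos t \<noteq> crit b"
      proof (cases "t \<le> pi")
        case True
        then show ?thesis using cos_inj_pi[of t a] a t elim by auto
      next
        case False
        have "cos t = cos (2 * pi - t)" by (simp add: cos_diff)
        then show ?thesis using cos_inj_pi[of "2 * pi - t" a] a t elim False by auto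
      qed
    qed
  qed
  then show ?thesis unfolding uniform_angle_def by (intro AE_uniform_measureI) auto
qed

section \<open>Zeros of the Faber polynomials\<close>

theorem theorem3p2:
  fixes R b :: real and F :: "nat \<Rightarrow> complex poly"
  assumes "R > 3 / 2" and "b = 1 - R"
    and "faber_polynomials (airfoil_map R) F"
  shows "(\<forall>N. open N \<and> loop_L b \<union> of_real ` interval_I b \<subseteq> N \<longrightarrow>
            (\<forall>\<^sub>F n in sequentially. \<forall>z. poly (F n) z = 0 \<longrightarrow> z \<in> N))
       \<and> weak_star_conv (\<lambda>n. normalized_zero_measure (F n))
            (add_measure (interval_part b) (loop_part b))"
proof
  note F = assms(3)
  have b: "b = 1 - R" "R \<noteq> 0" "b < - 1 / 2" and b0: "b < 0" using assms by auto
  show "\<forall>N. open N \<and> loop_L b \<union> of_real ` interval_I b \<subseteq> N \<longrightarrow>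
          (\<forall>\<^sub>F n in sequentially. \<forall>z. poly (F n) z = 0 \<longrightarrow> z \<in> N)"
    using zeros_accumulate[OF F b(1,2) b0] by blast
  show "weak_star_conv (\<lambda>n. normalized_zero_measure (F n)) (add_measure (interval_part b) (loop_part b))"
    unfolding weak_star_conv_def
  proof (intro allI impI)
    fix f :: "complex \<Rightarrow> real"
    assume f: "continuous_on UNIV f" "compact (closure {z. f z \<noteq> 0})"
    obtain M where M: "\<And>z. \<bar>f z\<bar> \<le> M" using bounded_of_compact_support[OF f] by blast
    have fm: "f \<in> borel_measurable borel" by (rule borel_measurable_continuous_onI[OF f(1)])
    have ex: "AE t in uniform_angle. \<forall>\<^sub>F n in sequentially. \<exists>z. cell_zero b (F n) n (cell_index n t) z"
      using AE_cos_not_crit[OF b(3)] AE_uniform_angle_range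
    proof eventually_elim
      case (elim t)
      then consider "crit b < cos t" | "cos t < crit b" by linarith
      then show ?case
      proof cases
        case 1
        show ?thesis using eventually_interval_zero[OF F b _ 1] elim
          by (auto simp: cell_zero_def elim: eventually_mono)
      next
        case 2
        show ?thesis using eventually_loop_zero[OF F b _ 2] elim
          by (auto simp: cell_zero_def elim: eventually_mono)
      qed
    qed
    have conv: "AE t in uniform_angle. \<forall>e>0. \<forall>\<^sub>F n in sequentially.
        \<forall>z. cell_zero b (F n) n (cell_index n t) z \<longrightarrow> dist z (limit_curve b t) < e"
      using AE_cos_not_crit[OF b(3)] AE_uniform_angle_range
    proof eventually_elim
      case (elim t)
      then consider "crit b < cos t" | "cos t < crit b" by linarith
      then show ?case
        using interval_zero_converges[OF b(3)] loop_zero_converges[OF b(3)] elim(2) by cases blast+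
    qed
    have "(\<lambda>n. integral\<^sup>L (normalized_zero_measure (F n)) f) \<longlonglongrightarrow> (\<integral>t. f (limit_curve b t) \<partial>uniform_angle)"
      by (rule zero_measure_limit_from_cells[where C = "\<lambda>n. cell_zero b (F n) n",
            OF faber_polynomial_nonzero[OF F b(1,2) b0] degree_faber_polynomial_le[OF F b(2)]
               cell_zero_is_zero cell_zero_inj[OF b(3)] ex conv limit_measure_eq_distr(1)[OF b(3)] f(1) M])
    also have "(\<integral>t. f (limit_curve b t) \<partial>uniform_angle)
        = integral\<^sup>L (add_measure (interval_part b) (loop_part b)) f"
      unfolding limit_measure_eq_distr(2)[OF b(3)]
      by (rule integral_distr[symmetric])
         (use limit_measure_eq_distr(1)[OF b(3)] fm in \<open>simp_all add: measurable_cong_sets[OF sets_uniform_angle refl]\<close>)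
    finally show "(\<lambda>n. integral\<^sup>L (normalized_zero_measure (F n)) f)
        \<longlonglongrightarrow> integral\<^sup>L (add_measure (interval_part b) (loop_part b)) f" .
  qed
qed

end
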